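(* Let $K$ be a discretely valued non-archimedean field with valuation ring $R$ and let $\ell=\operatorname{char}(K)$. Let $n\ge1$, $V=K^n$ with basis $x_1,\dots,x_n$, $d\ge1$ and $\lambda$ a partition of $d$. If $\lambda$ is $\ell$-core, then the representation $\rho_{n,\lambda}$ of $\mathrm{GL}(n,R)$ on $S_\lambda(V)$ is irreducible, i.e. $S_\lambda(V)$ has no proper nonzero $K$-subspace invariant under $\rho_{n,\lambda}(g)$ for all $g\in\mathrm{GL}(n,R)$.
   Context: $\mathrm{GL}(n,R)=\{g\in \mathrm{GL}(n,K): g,g^{-1}\in R^{n\times n}\}$ acts on $V$ by $x_i\cdot g=\sum_{j=1}^n g_{ij}x_j$. $S_\lambda(V)=c_\lambda\cdot V^{\otimes d}$ is the Weyl (Schur) module, with $c_\lambda$ the Young symmetrizer, and $\rho_{n,\lambda}:\mathrm{GL}(n,R)\to \mathrm{GL}(S_\lambda(V))$ is the representation obtained by applying the Schur functor to the action on $V$. For an integer $q\ge0$, a partition is $q$-core if none of its hook lengths is divisible by $q$ (by convention every partition is $0$-core). *)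

theory Defs
  imports "HOL-Analysis.Analysis" "HOL-Combinatorics.Permutations"
    "HOL-Library.Function_Algebras"
begin

subsection \<open>Discretely valued fields\<close>

text \<open>The value \<open>v 0\<close>, classically \<open>\<infinity>\<close>, is left unconstrained and never used. The last
  conjunct excludes the trivial valuation; the value group is then a nonzero subgroup of the
  integers, so \<open>v\<close> is normalised (surjective) up to a positive integer factor, and that factor does
  not affect the valuation ring.\<close>

definition discrete_valuation :: "('k::field \<Rightarrow> int) \<Rightarrow> bool" where
  "discrete_valuation v \<longleftrightarrow>
     (\<forall>x y. x \<noteq> 0 \<longrightarrow> y \<noteq> 0 \<longrightarrow> v (x * y) = v x + v y) \<and>
     (\<forall>x y. x \<noteq> 0 \<longrightarrow> y \<noteq> 0 \<longrightarrow> x + y \<noteq> 0 \<longrightarrow> v (x + y) \<ge> min (v x) (v y)) \<and>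
     (\<exists>x. x \<noteq> 0 \<and> v x \<noteq> 0)"

definition valuation_ring :: "('k::field \<Rightarrow> int) \<Rightarrow> 'k set" where
  "valuation_ring v = {x. x = 0 \<or> v x \<ge> 0}"

definition GL_over :: "'k::field set \<Rightarrow> ('k^'n^'n) set" where
  "GL_over R = {g. invertible g \<and> (\<forall>i j. g $ i $ j \<in> R) \<and> (\<forall>i j. matrix_inv g $ i $ j \<in> R)}"

subsection \<open>Partitions, hook lengths, cores\<close>

text \<open>Rows, columns and the entries of tableaux are numbered from 0.\<close>

definition partition_of :: "nat \<Rightarrow> nat list \<Rightarrow> bool" where
  "partition_of d lam \<longleftrightarrow> sorted_wrt (\<ge>) lam \<and> (\<forall>k \<in> set lam. k > 0) \<and> sum_list lam = d"

definition diagram :: "nat list \<Rightarrow> (nat \<times> nat) set" where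
  "diagram lam = {(i, j). i < length lam \<and> j < lam ! i}"

definition hook :: "nat list \<Rightarrow> nat \<times> nat \<Rightarrow> (nat \<times> nat) set" where
  "hook lam c = {(i, j) \<in> diagram lam. (i = fst c \<and> j \<ge> snd c) \<or> (j = snd c \<and> i \<ge> fst c)}"

definition hook_length :: "nat list \<Rightarrow> nat \<times> nat \<Rightarrow> nat" where
  "hook_length lam c = card (hook lam c)"

definition is_core :: "nat \<Rightarrow> nat list \<Rightarrow> bool" where
  "is_core q lam \<longleftrightarrow> (\<forall>c \<in> diagram lam. \<not> q dvd hook_length lam c)"

lemma finite_diagram: "finite (diagram lam)"
proof -
  have "diagram lam = (SIGMA i:{..<length lam}. {..<lam ! i})"
    by (auto simp: diagram_def)
  then show ?thesis by simp
qed

text \<open>The convention on 0-cores holds because hook lengths are positive.\<close>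

lemma is_core_0: "is_core 0 lam"
proof -
  have "hook_length lam c \<noteq> 0" if "c \<in> diagram lam" for c
  proof -
    have "c \<in> hook lam c" using that by (auto simp: hook_def)
    moreover have "finite (hook lam c)"
      by (rule finite_subset[OF _ finite_diagram[of lam]]) (auto simp: hook_def)
    ultimately show ?thesis by (auto simp: hook_length_def)
  qed
  then show ?thesis by (auto simp: is_core_def)
qed

subsection \<open>The Young symmetrizer\<close>

text \<open>The canonical tableau: the cells are numbered row by row.\<close>

definition tableau :: "nat list \<Rightarrow> nat \<times> nat \<Rightarrow> nat" where
  "tableau lam = (\<lambda>(i, j). sum_list (take i lam) + j)"

definition row_group :: "nat list \<Rightarrow> (nat \<Rightarrow> nat) set" where
  "row_group lam = {p. p permutes {..<sum_list lam} \<and>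
     (\<forall>i. p ` tableau lam ` {c \<in> diagram lam. fst c = i} = tableau lam ` {c \<in> diagram lam. fst c = i})}"

definition column_group :: "nat list \<Rightarrow> (nat \<Rightarrow> nat) set" where
  "column_group lam = {p. p permutes {..<sum_list lam} \<and>
     (\<forall>j. p ` tableau lam ` {c \<in> diagram lam. snd c = j} = tableau lam ` {c \<in> diagram lam. snd c = j})}"

text \<open>An element \<open>a\<close> of the group algebra of the symmetric group on \<open>{..<d}\<close> is given by its
  coefficients \<open>a p\<close> for \<open>p permutes {..<d}\<close>.\<close>

definition group_algebra_mult ::
    "nat \<Rightarrow> ((nat \<Rightarrow> nat) \<Rightarrow> 'k::field) \<Rightarrow> ((nat \<Rightarrow> nat) \<Rightarrow> 'k) \<Rightarrow> (nat \<Rightarrow> nat) \<Rightarrow> 'k" where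
  "group_algebra_mult d a b = (\<lambda>s. \<Sum>p | p permutes {..<d}. a p * b (inv p \<circ> s))"

definition row_symmetrizer :: "nat list \<Rightarrow> (nat \<Rightarrow> nat) \<Rightarrow> 'k::field" where
  "row_symmetrizer lam = (\<lambda>p. if p \<in> row_group lam then 1 else 0)"

definition column_antisymmetrizer :: "nat list \<Rightarrow> (nat \<Rightarrow> nat) \<Rightarrow> 'k::field" where
  "column_antisymmetrizer lam = (\<lambda>p. if p \<in> column_group lam then of_int (sign p) else 0)"

definition young_symmetrizer :: "nat list \<Rightarrow> (nat \<Rightarrow> nat) \<Rightarrow> 'k::field" where
  "young_symmetrizer lam =
     group_algebra_mult (sum_list lam) (row_symmetrizer lam) (column_antisymmetrizer lam)"

subsection \<open>Tensor powers\<close>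

text \<open>The \<open>d\<close>-th tensor power of \<open>V = 'k^'n\<close> has the basis of all \<open>x\<^bsub>w 0\<^esub> \<otimes> \<dots> \<otimes> x\<^bsub>w (d-1)\<^esub>\<close>, for
  words \<open>w\<close> of length \<open>d\<close> over \<open>'n\<close>. A tensor is the family of its coordinates in this basis,
  extended by 0 to words of other lengths.\<close>

definition tensor_power :: "nat \<Rightarrow> ('n::finite list \<Rightarrow> 'k::field) set" where
  "tensor_power d = {t. \<forall>w. length w \<noteq> d \<longrightarrow> t w = 0}"

definition tensor_scale :: "'k::field \<Rightarrow> ('n::finite list \<Rightarrow> 'k) \<Rightarrow> ('n list \<Rightarrow> 'k)" where
  "tensor_scale a t = (\<lambda>w. a * t w)"

interpretation tensor: vector_space "tensor_scale :: 'k::field \<Rightarrow> ('n::finite list \<Rightarrow> 'k) \<Rightarrow> _"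
  by unfold_locales (auto simp: tensor_scale_def fun_eq_iff algebra_simps)

definition pure_tensor :: "('k::field^'n) list \<Rightarrow> ('n::finite list \<Rightarrow> 'k)" where
  "pure_tensor vs =
     (\<lambda>w. if length w = length vs then \<Prod>i<length vs. vs ! i $ (w ! i) else 0)"

text \<open>Left place permutation, \<open>p \<cdot> (v\<^sub>0 \<otimes> \<dots> \<otimes> v\<^bsub>d-1\<^esub>) = v\<^bsub>p\<inverse> 0\<^esub> \<otimes> \<dots> \<otimes> v\<^bsub>p\<inverse> (d-1)\<^esub>\<close>;
  see \<open>place_permutation_pure_tensor\<close>.\<close>

definition place_permutation ::
    "(nat \<Rightarrow> nat) \<Rightarrow> ('n::finite list \<Rightarrow> 'k::field) \<Rightarrow> ('n list \<Rightarrow> 'k)" where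
  "place_permutation p t = (\<lambda>w. t (permute_list p w))"

definition group_algebra_act ::
    "nat \<Rightarrow> ((nat \<Rightarrow> nat) \<Rightarrow> 'k::field) \<Rightarrow> ('n::finite list \<Rightarrow> 'k) \<Rightarrow> ('n list \<Rightarrow> 'k)" where
  "group_algebra_act d a t = (\<Sum>p | p permutes {..<d}. tensor_scale (a p) (place_permutation p t))"

text \<open>The diagonal action of \<open>g\<close>, linear with \<open>v\<^sub>0 \<otimes> \<dots> \<otimes> v\<^bsub>d-1\<^esub> \<mapsto> v\<^sub>0\<cdot>g \<otimes> \<dots> \<otimes> v\<^bsub>d-1\<^esub>\<cdot>g\<close>, where
  \<open>x\<^sub>i\<cdot>g = (\<Sum>j. g\<^sub>i\<^sub>j x\<^sub>j)\<close>, i.e. \<open>v\<cdot>g = v v* g\<close> (a right action); see \<open>tensor_act_pure_tensor\<close>.\<close>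

definition tensor_act ::
    "'k::field^'n^'n \<Rightarrow> ('n::finite list \<Rightarrow> 'k) \<Rightarrow> ('n list \<Rightarrow> 'k)" where
  "tensor_act g t =
     (\<lambda>w. \<Sum>u | length u = length w. t u * (\<Prod>i<length w. g $ (u ! i) $ (w ! i)))"

subsection \<open>Schur modules\<close>

definition schur_module :: "nat list \<Rightarrow> ('n::finite list \<Rightarrow> 'k::field) set" where
  "schur_module lam =
     group_algebra_act (sum_list lam) (young_symmetrizer lam) ` tensor_power (sum_list lam)"

definition schur_rep ::
    "nat list \<Rightarrow> 'k::field^'n^'n \<Rightarrow> ('n::finite list \<Rightarrow> 'k) \<Rightarrow> ('n list \<Rightarrow> 'k)" where
  "schur_rep lam g = restrict (tensor_act g) (schur_module lam)"

subsection \<open>Consistency of the definitions\<close>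

lemma finite_words: "finite {u :: 'n::finite list. length u = d}"
  using finite_lists_length_eq[of "UNIV :: 'n set" d] by simp

lemma sum_words_prod:
  fixes f :: "nat \<Rightarrow> 'n::finite \<Rightarrow> 'k::field"
  shows "(\<Sum>u | length u = d. \<Prod>i<d. f i (u ! i)) = (\<Prod>i<d. \<Sum>a\<in>UNIV. f i a)"
proof (induction d arbitrary: f)
  case 0
  have "{u :: 'n list. length u = 0} = {[]}" by auto
  then show ?case by simp
next
  case (Suc d)
  have eq: "{u :: 'n list. length u = Suc d} = (\<lambda>(a, u). a # u) ` (UNIV \<times> {u. length u = d})"
    by (auto simp: length_Suc_conv image_iff)
  have inj: "inj_on (\<lambda>(a, u). a # u) (UNIV \<times> {u :: 'n list. length u = d})"
    by (auto simp: inj_on_def)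
  have "(\<Sum>u | length u = Suc d. \<Prod>i<Suc d. f i (u ! i))
      = (\<Sum>(a, u) \<in> UNIV \<times> {u. length u = d}. \<Prod>i<Suc d. f i ((a # u) ! i))"
    unfolding eq by (subst sum.reindex[OF inj]) (simp add: case_prod_unfold)
  also have "\<dots> = (\<Sum>(a, u) \<in> UNIV \<times> {u. length u = d}. f 0 a * (\<Prod>i<d. f (Suc i) (u ! i)))"
    unfolding prod.lessThan_Suc_shift by simp
  also have "\<dots> = (\<Sum>a\<in>UNIV. f 0 a) * (\<Sum>u | length u = d. \<Prod>i<d. f (Suc i) (u ! i))"
    by (simp add: sum_product sum.cartesian_product)
  also have "\<dots> = (\<Prod>i<Suc d. \<Sum>a\<in>UNIV. f i a)"
    unfolding prod.lessThan_Suc_shift by (simp add: Suc.IH[of "\<lambda>i. f (Suc i)"])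
  finally show ?case .
qed

lemma tensor_act_pure_tensor:
  "tensor_act g (pure_tensor vs) = pure_tensor (map (\<lambda>x. x v* g) vs)"
proof
  fix w :: "'a list"
  show "tensor_act g (pure_tensor vs) w = pure_tensor (map (\<lambda>x. x v* g) vs) w"
  proof (cases "length w = length vs")
    case True
    have "tensor_act g (pure_tensor vs) w =
        (\<Sum>u | length u = length vs. \<Prod>i<length vs. vs ! i $ (u ! i) * g $ (u ! i) $ (w ! i))"
      using True by (simp add: tensor_act_def pure_tensor_def prod.distrib)
    also have "\<dots> = (\<Prod>i<length vs. \<Sum>a\<in>UNIV. vs ! i $ a * g $ a $ (w ! i))"
      by (rule sum_words_prod)
    finally show ?thesis
      using True by (simp add: pure_tensor_def vector_matrix_mult_def mult.commute)
  qed (simp add: tensor_act_def pure_tensor_def)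
qed

lemma place_permutation_pure_tensor:
  assumes "p permutes {..<length vs}"
  shows "place_permutation p (pure_tensor vs) = pure_tensor (permute_list (inv p) vs)"
proof
  fix w :: "'b list"
  show "place_permutation p (pure_tensor vs) w = pure_tensor (permute_list (inv p) vs) w"
  proof (cases "length w = length vs")
    case True
    have "(\<Prod>i<length vs. vs ! i $ (permute_list p w ! i)) = (\<Prod>i<length vs. vs ! i $ (w ! p i))"
      using assms True by (intro prod.cong) (auto simp: permute_list_nth)
    also have "\<dots> = (\<Prod>i<length vs. vs ! inv p i $ (w ! p (inv p i)))"
      by (subst prod.permute[OF permutes_inv[OF assms]]) (simp add: o_def)
    also have "\<dots> = (\<Prod>i<length vs. permute_list (inv p) vs ! i $ (w ! i))"
      using permutes_inv[OF assms]
      by (intro prod.cong) (auto simp: permute_list_nth permutes_inverses[OF assms])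
    finally show ?thesis using True by (simp add: place_permutation_def pure_tensor_def)
  qed (simp add: place_permutation_def pure_tensor_def)
qed

lemma tensor_power_eq_span:
  "tensor_power d = tensor.span {pure_tensor vs | vs. length vs = d}" (is "_ = tensor.span ?P")
proof
  have "?P \<subseteq> tensor_power d" by (auto simp: tensor_power_def pure_tensor_def)
  moreover have "tensor.subspace (tensor_power d)"
    by (auto simp: tensor.subspace_def tensor_power_def tensor_scale_def)
  ultimately show "tensor.span ?P \<subseteq> tensor_power d" by (rule tensor.span_minimal)
next
  show "tensor_power d \<subseteq> tensor.span ?P"
  proof
    fix t :: "'a list \<Rightarrow> 'b" assume t: "t \<in> tensor_power d"
    define b :: "'a list \<Rightarrow> 'a list \<Rightarrow> 'b" where "b u = pure_tensor (map (\<lambda>i. axis i 1) u)" for u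
    have b: "b u w = (if w = u then 1 else 0)" for u w
    proof (cases "length w = length u \<and> w \<noteq> u")
      case True
      then obtain i where "i < length u" "w ! i \<noteq> u ! i" by (auto simp: list_eq_iff_nth_eq)
      then show ?thesis using True by (auto simp: b_def pure_tensor_def axis_def)
    qed (auto simp: b_def pure_tensor_def axis_def)
    have sum_apply: "(\<Sum>u\<in>A. h u) w = (\<Sum>u\<in>A. h u w)"
      for A and h :: "'a list \<Rightarrow> 'a list \<Rightarrow> 'b" and w
      by (induction A rule: infinite_finite_induct) auto
    have "t = (\<Sum>u | length u = d. tensor_scale (t u) (b u))"
      using t by (auto simp: fun_eq_iff sum_apply tensor_scale_def b finite_words
          tensor_power_def if_distrib cong: if_cong)
    also have "\<dots> \<in> tensor.span ?P"
    proof (intro tensor.span_sum tensor.span_scale tensor.span_base)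
      fix u :: "'a list" assume "u \<in> {u. length u = d}"
      then show "b u \<in> ?P" by (auto simp: b_def intro!: exI[of _ "map (\<lambda>i. axis i 1) u"])
    qed
    finally show "t \<in> tensor.span ?P" .
  qed
qed

lemma tensor_act_in_tensor_power: "t \<in> tensor_power d \<Longrightarrow> tensor_act g t \<in> tensor_power d"
  by (auto simp: tensor_power_def tensor_act_def)

lemma tensor_act_place_permutation:
  fixes t :: "'n::finite list \<Rightarrow> 'k::field"
  assumes p: "p permutes {..<d}" and t: "t \<in> tensor_power d"
  shows "tensor_act g (place_permutation p t) = place_permutation p (tensor_act g t)"
proof
  fix w :: "'n list"
  show "tensor_act g (place_permutation p t) w = place_permutation p (tensor_act g t) w"
  proof (cases "length w = d")
    case True
    have inv: "permute_list (inv p) (permute_list p u) = u"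
              "permute_list p (permute_list (inv p) u) = u" if "length u = d" for u :: "'n list"
      using that p permutes_inv[OF p]
      by (simp_all flip: permute_list_compose add: permutes_inv_o)
    have "(\<Sum>u | length u = d. t (permute_list p u) * (\<Prod>i<d. g $ (u ! i) $ (w ! i))) =
        (\<Sum>u | length u = d. t u * (\<Prod>i<d. g $ (u ! i) $ (permute_list p w ! i)))"
    proof (rule sum.reindex_bij_witness[where i = "permute_list (inv p)" and j = "permute_list p"])
      fix u :: "'n list" assume u: "u \<in> {u. length u = d}"
      have "(\<Prod>i<d. g $ (u ! i) $ (w ! i)) = (\<Prod>i<d. g $ (u ! p i) $ (w ! p i))"
        by (subst prod.permute[OF p]) (simp add: o_def)
      also have "\<dots> = (\<Prod>i<d. g $ (permute_list p u ! i) $ (permute_list p w ! i))"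
        using u p True by (intro prod.cong) (auto simp: permute_list_nth)
      finally show "t (permute_list p u) * (\<Prod>i<d. g $ (permute_list p u ! i) $ (permute_list p w ! i))
          = t (permute_list p u) * (\<Prod>i<d. g $ (u ! i) $ (w ! i))" by simp
    qed (auto simp: inv)
    then show ?thesis using True by (simp add: tensor_act_def place_permutation_def)
  next
    case False
    then show ?thesis using t
      by (simp add: tensor_act_def place_permutation_def tensor_power_def)
  qed
qed

lemma tensor_act_add: "tensor_act g (s + t) = tensor_act g s + tensor_act g t"
  by (auto simp: tensor_act_def fun_eq_iff algebra_simps sum.distrib)

lemma tensor_act_scale: "tensor_act g (tensor_scale a t) = tensor_scale a (tensor_act g t)"
  by (auto simp: tensor_act_def tensor_scale_def fun_eq_iff algebra_simps sum_distrib_left)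

lemma tensor_act_sum: "tensor_act g (\<Sum>x\<in>A. f x) = (\<Sum>x\<in>A. tensor_act g (f x))"
proof (induction A rule: infinite_finite_induct)
  case (insert x F)
  then show ?case by (simp only: sum.insert[OF insert(1,2)] tensor_act_add)
qed (simp_all add: tensor_act_def fun_eq_iff)

lemma tensor_act_schur_module:
  assumes "t \<in> schur_module lam"
  shows "tensor_act g t \<in> schur_module lam"
proof -
  obtain s where s: "s \<in> tensor_power (sum_list lam)"
      "t = group_algebra_act (sum_list lam) (young_symmetrizer lam) s"
    using assms by (auto simp: schur_module_def)
  have "tensor_act g t = group_algebra_act (sum_list lam) (young_symmetrizer lam) (tensor_act g s)"
    using s(1) by (auto simp: s(2) group_algebra_act_def tensor_act_sum tensor_act_scale
        tensor_act_place_permutation intro!: sum.cong)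
  then show ?thesis
    using tensor_act_in_tensor_power[OF s(1)] by (auto simp: schur_module_def)
qed

end

theory Submission
  imports Defs "HOL-Library.Poly_Mapping"
begin

text \<open>Write \<open>c = a b\<close> for the Young symmetrizer, \<open>H\<close> for the product of the hook lengths and \<open>U\<close> for
  the tensor power. Over the integers, \<open>c \<sigma> c = H c(\<sigma>\<inverse>) c\<close> for every permutation \<open>\<sigma>\<close>, where \<open>c(\<sigma>\<inverse>)\<close> is
  a coefficient of \<open>c\<close>; for \<open>\<sigma> = 1\<close> this is the hook length formula \<open>c c = H c\<close>. The core condition
  says that \<open>H\<close> is nonzero in \<open>K\<close>. For \<open>w, u\<close> in \<open>c U\<close> and a linear form \<open>f\<close> on \<open>U\<close>, the equivariant map
  \<open>x \<mapsto> (\<Sum>\<sigma>. f (\<sigma>\<inverse> x) \<sigma> u)\<close> therefore sends \<open>w\<close> to \<open>H f(w) u\<close>. A subspace invariant under \<open>GL(n,R)\<close> is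
  invariant under every matrix, since \<open>x\<^sup>\<otimes>\<^sup>d\<close> is the top coefficient in \<open>t\<close> of \<open>(1 + t x)\<^sup>\<otimes>\<^sup>d\<close> and \<open>1 + t x\<close>
  is in \<open>GL(n,R)\<close> for all \<open>t\<close> of large valuation; by polarization it is then invariant under these
  equivariant maps. So a nonzero invariant subspace of \<open>c U\<close> contains every \<open>u\<close>.

  The hook length formula is proved by removing the first column of the diagram, as in the evaluation
  of the Capelli determinant on a highest weight vector; two Garnir relations take the place of the
  invariance under unipotent matrices.\<close>

subsection \<open>The group ring of finitary permutations\<close>

text \<open>Permutations of finite support as a type: they form a group on which the sign is defined
  everywhere, and the finitely supported integer functions on it form its group ring, with no
  carrier set to keep track of.\<close>

typedef 'a fperm = "{p :: 'a \<Rightarrow> 'a. permutation p}" morphisms app Fperm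
  by (rule exI[of _ id]) simp

setup_lifting type_definition_fperm

text \<open>Composition is written additively, since the product of \<open>'a \<Rightarrow>\<^sub>0 'b\<close> adds the keys.\<close>

instantiation fperm :: (type) group_add
begin

lift_definition zero_fperm :: "'a fperm" is id by simp
lift_definition plus_fperm :: "'a fperm \<Rightarrow> 'a fperm \<Rightarrow> 'a fperm" is "(\<circ>)"
  by (rule permutation_compose)
lift_definition uminus_fperm :: "'a fperm \<Rightarrow> 'a fperm" is inv
  by (rule permutation_inverse)
lift_definition minus_fperm :: "'a fperm \<Rightarrow> 'a fperm \<Rightarrow> 'a fperm" is "\<lambda>p q. p \<circ> inv q"
  by (intro permutation_compose permutation_inverse)

instance
  by standard (transfer; auto simp: o_assoc permutation_inverse_works)+

end

lift_definition sgnp :: "'a fperm \<Rightarrow> int" is sign .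
lift_definition swp :: "'a \<Rightarrow> 'a \<Rightarrow> 'a fperm" is Transposition.transpose by (rule permutation_swap_id)

lemma fperm_eqI: "(\<And>x. app p x = app q x) \<Longrightarrow> p = q"
  by (metis app_inject ext)

lemma app_zero [simp]: "app 0 x = x"
  by transfer simp

lemma app_plus [simp]: "app (p + q) x = app p (app q x)"
  by transfer simp

lemma app_swp [simp]: "app (swp x y) z = Transposition.transpose x y z"
  by transfer simp

lemma app_uminus_app [simp]: "app (- p) (app p x) = x"
  by (metis app_plus app_zero add.left_inverse)

lemma app_app_uminus [simp]: "app p (app (- p) x) = x"
  by (metis app_plus app_zero add.right_inverse)

lemma app_eq_iff [simp]: "app p x = app p y \<longleftrightarrow> x = y"
  by (metis app_uminus_app)

lemma app_uminus_eq_iff: "app (- p) x = y \<longleftrightarrow> x = app p y"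
  by auto

lemma app_Fperm: "permutation p \<Longrightarrow> app (Fperm p) = p"
  by (simp add: Fperm_inverse)

lemma bij_app: "bij (app p)"
  by transfer (rule permutation_bijective)

lemma swp_same [simp]: "swp x x = 0"
  by (rule fperm_eqI) simp

lemma swp_swp [simp]: "swp x y + swp x y = 0"
  by (rule fperm_eqI) simp

lemma uminus_swp [simp]: "- swp x y = swp x y"
  by (rule minus_unique) simp

lemma swp_commute: "swp x y = swp y x"
  by (rule fperm_eqI) (simp add: transpose_commute)

text \<open>The conjugation rule for transpositions; it is the device by which transpositions are
  moved past other permutations below.\<close>

lemma add_swp: "p + swp x y = swp (app p x) (app p y) + p"
  by (rule fperm_eqI) (auto simp: Transposition.transpose_def)

lemma swp_add: "swp x y + p = p + swp (app (- p) x) (app (- p) y)"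
  by (simp add: add_swp)

lemma sgnp_zero [simp]: "sgnp 0 = 1"
  by transfer simp

lemma sgnp_plus [simp]: "sgnp (p + q) = sgnp p * sgnp q"
  by transfer (rule sign_compose)

lemma sgnp_uminus [simp]: "sgnp (- p) = sgnp p"
  by transfer (rule sign_inverse)

lemma sgnp_swp: "x \<noteq> y \<Longrightarrow> sgnp (swp x y) = - 1"
  by transfer (simp add: sign_swap_id)

lemma sgnp_square [simp]: "sgnp p * sgnp p = 1"
  by transfer simp

section \<open>The integral group ring\<close>

type_synonym 'a group_ring = "'a fperm \<Rightarrow>\<^sub>0 int"

abbreviation gelem :: "'a fperm \<Rightarrow> 'a group_ring" where
  "gelem p \<equiv> Poly_Mapping.single p 1"

lemma gelem_plus: "gelem (p + q) = gelem p * gelem q"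
  by (simp add: mult_single)

lemma mult_of_int_left_commute: "(x :: 'b::ring_1) * (of_int a * y) = of_int a * (x * y)"
  by (metis mult.assoc mult_of_int_commute)

lemma scaled_gelem_mult:
  "(of_int a * gelem p) * (of_int b * gelem q) = of_int (a * b) * gelem (p + q)"
proof -
  have "of_int a * gelem p = Poly_Mapping.single p a" for a :: int and p :: "'a fperm"
  proof -
    have "of_int a = (Poly_Mapping.single 0 a :: 'a group_ring)"
      by (metis single_of_int of_int_eq_id id_apply)
    then show ?thesis by (simp only: mult_single) simp
  qed
  then show ?thesis by (simp only: mult_single)
qed

lemma lookup_of_nat_mult:
  fixes x :: "('a::monoid_add) \<Rightarrow>\<^sub>0 int"
  shows "Poly_Mapping.lookup (of_nat n * x) k = of_nat n * Poly_Mapping.lookup x k"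
  by (induction n) (auto simp: algebra_simps lookup_add)

lemma lookup_of_int_mult:
  fixes x :: "('a::monoid_add) \<Rightarrow>\<^sub>0 int"
  shows "Poly_Mapping.lookup (of_int n * x) k = n * Poly_Mapping.lookup x k"
  by (cases n rule: int_cases2) (auto simp: lookup_of_nat_mult)

text \<open>With integer coefficients the group ring is torsion-free. This is why the computation
  stays over the integers: orders of subgroups and factorials can be cancelled there, whatever the
  characteristic of \<open>K\<close>.\<close>

lemma of_nat_mult_cancel:
  fixes x y :: "('a::monoid_add) \<Rightarrow>\<^sub>0 int"
  assumes "of_nat n * x = of_nat n * y" "n \<noteq> 0"
  shows "x = y"
proof (rule poly_mapping_eqI)
  fix k
  have "Poly_Mapping.lookup (of_nat n * x) k = Poly_Mapping.lookup (of_nat n * y) k" using assms by simp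
  then show "Poly_Mapping.lookup x k = Poly_Mapping.lookup y k"
    using assms(2) unfolding lookup_of_nat_mult by simp
qed

lemma eq_uminus_imp_zero:
  fixes x :: "('a::monoid_add) \<Rightarrow>\<^sub>0 int"
  assumes "x = - x"
  shows "x = 0"
proof (rule poly_mapping_eqI)
  fix k
  have "Poly_Mapping.lookup x k = Poly_Mapping.lookup (- x) k" using assms by simp
  then show "Poly_Mapping.lookup x k = Poly_Mapping.lookup 0 k" by simp
qed

lemma lookup_gelem_mult:
  fixes x :: "'a group_ring"
  shows "Poly_Mapping.lookup (gelem p * x) s = Poly_Mapping.lookup x (- p + s)"
proof -
  have eq: "s = p + q \<longleftrightarrow> q = - p + s" for q
    by (metis add.assoc add.left_inverse add.right_inverse add_0)
  have "Poly_Mapping.lookup (gelem p) l * z = (z when l = p)" for l z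
    by (auto simp: lookup_single when_def)
  then show ?thesis unfolding lookup_mult by (simp add: eq)
qed

lemma lookup_mult_gelem:
  fixes x :: "'a group_ring"
  shows "Poly_Mapping.lookup (x * gelem p) s = Poly_Mapping.lookup x (s - p)"
proof -
  have eq: "s = l + q \<longleftrightarrow> q = - l + s" for l q
    by (metis add.assoc add.left_inverse add.right_inverse add_0)
  have "Poly_Mapping.lookup x l * Poly_Mapping.lookup (gelem p) (- l + s)
    = (Poly_Mapping.lookup x l when l = s - p)" for l
  proof -
    have "p = - l + s \<longleftrightarrow> l = s - p"
      by (metis eq eq_diff_eq)
    then show ?thesis by (auto simp: lookup_single when_def)
  qed
  then show ?thesis unfolding lookup_mult by (simp add: eq)
qed

section \<open>Young subgroups and their signed sums\<close>

definition stab :: "'a set \<Rightarrow> ('a \<Rightarrow> 'b) \<Rightarrow> 'a fperm set" where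
  "stab X f = {p. (\<forall>x. x \<notin> X \<longrightarrow> app p x = x) \<and> (\<forall>x\<in>X. f (app p x) = f x)}"

lemma stab_fix: "p \<in> stab X f \<Longrightarrow> x \<notin> X \<Longrightarrow> app p x = x"
  by (auto simp: stab_def)

lemma stab_label: "p \<in> stab X f \<Longrightarrow> f (app p x) = f x"
  by (cases "x \<in> X") (auto simp: stab_def)

lemma app_stab_mem: "p \<in> stab X f \<Longrightarrow> app p x \<in> X \<longleftrightarrow> x \<in> X"
  by (metis app_eq_iff stab_fix)

lemma stab_zero [simp]: "0 \<in> stab X f"
  by (auto simp: stab_def)

lemma stab_plus: "p \<in> stab X f \<Longrightarrow> q \<in> stab X f \<Longrightarrow> p + q \<in> stab X f"
  using app_stab_mem[of q X f] by (auto simp: stab_def)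

lemma stab_uminus: "p \<in> stab X f \<Longrightarrow> - p \<in> stab X f"
proof -
  assume p: "p \<in> stab X f"
  then have "app (- p) x = x" if "x \<notin> X" for x using that by (simp add: app_uminus_eq_iff stab_fix)
  moreover have "f (app (- p) x) = f x" for x
    using stab_label[OF p, of "app (- p) x"] by simp
  ultimately show ?thesis by (auto simp: stab_def)
qed

lemma stab_swp: "x \<in> X \<Longrightarrow> y \<in> X \<Longrightarrow> f x = f y \<Longrightarrow> swp x y \<in> stab X f"
  by (auto simp: stab_def Transposition.transpose_def)

lemma stab_mono:
  assumes "X \<subseteq> Y" "\<And>x y. x \<in> X \<Longrightarrow> y \<in> X \<Longrightarrow> f x = f y \<Longrightarrow> g x = g y"
  shows "stab X f \<subseteq> stab Y g"
proof
  fix p assume p: "p \<in> stab X f"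
  have "g (app p x) = g x" for x
  proof (cases "x \<in> X")
    case True
    then show ?thesis using assms(2) app_stab_mem[OF p] stab_label[OF p] by blast
  qed (use p stab_fix in fastforce)
  then show "p \<in> stab Y g" using stab_fix[OF p] assms(1) by (auto simp: stab_def)
qed

lemma finite_stab: "finite X \<Longrightarrow> finite (stab X f)"
proof -
  assume X: "finite X"
  have "app ` stab X f \<subseteq> {p. p permutes X}"
    by (auto simp: stab_def permutes_def) (metis app_app_uminus app_eq_iff)+
  then have "finite (app ` stab X f)" using X finite_permutations finite_subset by blast
  moreover have "inj app" by (meson app_inject injI)
  ultimately show ?thesis by (meson finite_imageD inj_on_subset subset_UNIV)
qed

text \<open>With the trivial character and row labels this is a row symmetrizer, with
  \<open>sgnp\<close> and column labels a column antisymmetrizer, and with a constant label the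
  signed sum over a full symmetric group. A general character lets each fact be proved once for both
  signs.\<close>

definition stab_sum :: "('a fperm \<Rightarrow> int) \<Rightarrow> 'a set \<Rightarrow> ('a \<Rightarrow> 'b) \<Rightarrow> 'a group_ring" where
  "stab_sum \<epsilon> X f = (\<Sum>p\<in>stab X f. of_int (\<epsilon> p) * gelem p)"

definition perm_character :: "('a fperm \<Rightarrow> int) \<Rightarrow> bool" where
  "perm_character \<epsilon> \<longleftrightarrow> (\<forall>p q. \<epsilon> (p + q) = \<epsilon> p * \<epsilon> q) \<and> (\<forall>p. \<epsilon> p * \<epsilon> p = 1)"

lemma perm_character_one: "perm_character (\<lambda>_. 1)"
  and perm_character_sgnp: "perm_character sgnp"
  by (auto simp: perm_character_def)

lemma perm_character_zero: "perm_character \<epsilon> \<Longrightarrow> \<epsilon> 0 = 1"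
  unfolding perm_character_def by (metis add_0)

text \<open>Translation by \<open>p\<close> permutes the subgroup, and \<open>\<epsilon> p\<close>
  can be moved to the other side because its square is 1.\<close>

lemma gelem_mult_stab_sum:
  assumes "perm_character \<epsilon>" "p \<in> stab X f"
  shows "gelem p * stab_sum \<epsilon> X f = of_int (\<epsilon> p) * stab_sum \<epsilon> X f"
proof -
  have "stab_sum \<epsilon> X f = (\<Sum>q\<in>stab X f. of_int (\<epsilon> (p + q)) * gelem (p + q))"
    unfolding stab_sum_def
    by (rule sum.reindex_bij_witness[of _ "\<lambda>q. p + q" "\<lambda>q. - p + q"])
      (use assms in \<open>auto simp: stab_plus stab_uminus add.assoc[symmetric]\<close>)
  also have "\<dots> = (of_int (\<epsilon> p) * gelem p) * stab_sum \<epsilon> X f"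
    using assms(1) unfolding perm_character_def stab_sum_def sum_distrib_left
    by (intro sum.cong) (simp_all only: scaled_gelem_mult)
  also have "\<dots> = of_int (\<epsilon> p) * (gelem p * stab_sum \<epsilon> X f)"
    by (simp add: mult.assoc)
  finally have "of_int (\<epsilon> p) * stab_sum \<epsilon> X f = of_int (\<epsilon> p * \<epsilon> p) * (gelem p * stab_sum \<epsilon> X f)"
    by (simp add: mult.assoc)
  then show ?thesis using assms(1) by (simp add: perm_character_def del: of_int_mult)
qed

lemma stab_sum_mult_gelem:
  assumes "perm_character \<epsilon>" "p \<in> stab X f"
  shows "stab_sum \<epsilon> X f * gelem p = of_int (\<epsilon> p) * stab_sum \<epsilon> X f"
proof -
  have "stab_sum \<epsilon> X f = (\<Sum>q\<in>stab X f. of_int (\<epsilon> (q + p)) * gelem (q + p))"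
    unfolding stab_sum_def
    by (rule sum.reindex_bij_witness[of _ "\<lambda>q. q + p" "\<lambda>q. q - p"])
      (use assms in \<open>auto simp: stab_plus stab_uminus diff_conv_add_uminus add.assoc
        simp del: add_uminus_conv_diff\<close>)
  also have "\<dots> = stab_sum \<epsilon> X f * (of_int (\<epsilon> p) * gelem p)"
    using assms(1) unfolding perm_character_def stab_sum_def sum_distrib_right
    by (intro sum.cong) (simp_all only: scaled_gelem_mult)
  also have "\<dots> = of_int (\<epsilon> p) * (stab_sum \<epsilon> X f * gelem p)"
    by (simp add: mult_of_int_left_commute)
  finally have "of_int (\<epsilon> p) * stab_sum \<epsilon> X f = of_int (\<epsilon> p * \<epsilon> p) * (stab_sum \<epsilon> X f * gelem p)"
    by (simp add: mult.assoc)
  then show ?thesis using assms(1) by (simp add: perm_character_def del: of_int_mult)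
qed

text \<open>Coset decomposition along the stabilizer of \<open>x\<close>: every \<open>p\<close> is
  uniquely \<open>swp x y + h\<close> with \<open>y = app p x\<close> and \<open>h\<close> fixing
  \<open>x\<close>. The lemma after it decomposes from the other side, with
  \<open>y = app (- p) x\<close>.\<close>

lemma stab_sum_insert_left:
  assumes \<epsilon>: "perm_character \<epsilon>" and X: "finite X" "x \<in> X"
  shows "stab_sum \<epsilon> X f
    = (\<Sum>y | y \<in> X \<and> f y = f x. of_int (\<epsilon> (swp x y)) * gelem (swp x y)) * stab_sum \<epsilon> (X - {x}) f"
proof -
  let ?Y = "{y \<in> X. f y = f x}" and ?H = "stab (X - {x}) f"
  have H: "?H \<subseteq> stab X f" by (rule stab_mono) auto
  have "stab_sum \<epsilon> X f = (\<Sum>(y, h)\<in>?Y \<times> ?H. of_int (\<epsilon> (swp x y + h)) * gelem (swp x y + h))"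
    unfolding stab_sum_def
  proof (rule sum.reindex_bij_witness[of _ "\<lambda>(y, h). swp x y + h"
        "\<lambda>p. (app p x, swp x (app p x) + p)"])
    fix p assume p: "p \<in> stab X f"
    have "swp x (app p x) + p \<in> stab X f"
      using p X by (intro stab_plus stab_swp) (auto simp: app_stab_mem stab_label)
    then have "swp x (app p x) + p \<in> ?H" by (auto simp: stab_def)
    then show "(app p x, swp x (app p x) + p) \<in> ?Y \<times> ?H"
      using p X by (auto simp: app_stab_mem stab_label)
  next
    fix z assume z: "z \<in> ?Y \<times> ?H"
    then obtain y h where [simp]: "z = (y, h)" and y: "y \<in> ?Y" "h \<in> ?H" by auto
    have [simp]: "app h x = x" using y(2) by (auto simp: stab_def)
    show "(case z of (y, h) \<Rightarrow> swp x y + h) \<in> stab X f"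
      using y H X by (auto intro!: stab_plus stab_swp)
    show "(app (case z of (y, h) \<Rightarrow> swp x y + h) x,
        swp x (app (case z of (y, h) \<Rightarrow> swp x y + h) x) + (case z of (y, h) \<Rightarrow> swp x y + h)) = z"
      by (simp add: add.assoc[symmetric])
  qed (auto simp: add.assoc[symmetric])
  also have "\<dots> = (\<Sum>y\<in>?Y. \<Sum>h\<in>?H. (of_int (\<epsilon> (swp x y)) * gelem (swp x y)) * (of_int (\<epsilon> h) * gelem h))"
    unfolding sum.cartesian_product using \<epsilon>
    by (intro sum.cong) (auto simp only: perm_character_def scaled_gelem_mult)
  finally show ?thesis by (simp add: stab_sum_def sum_product)
qed

lemma stab_sum_insert_right:
  assumes \<epsilon>: "perm_character \<epsilon>" and X: "finite X" "x \<in> X"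
  shows "stab_sum \<epsilon> X f
    = stab_sum \<epsilon> (X - {x}) f * (\<Sum>y | y \<in> X \<and> f y = f x. of_int (\<epsilon> (swp x y)) * gelem (swp x y))"
proof -
  let ?Y = "{y \<in> X. f y = f x}" and ?H = "stab (X - {x}) f"
  have H: "?H \<subseteq> stab X f" by (rule stab_mono) auto
  have "stab_sum \<epsilon> X f = (\<Sum>(h, y)\<in>?H \<times> ?Y. of_int (\<epsilon> (h + swp x y)) * gelem (h + swp x y))"
    unfolding stab_sum_def
  proof (rule sum.reindex_bij_witness[of _ "\<lambda>(h, y). h + swp x y"
        "\<lambda>p. (p + swp x (app (- p) x), app (- p) x)"])
    fix p assume p: "p \<in> stab X f"
    have "p + swp x (app (- p) x) \<in> stab X f"
      using stab_uminus[OF p] p X by (intro stab_plus stab_swp) (auto simp: app_stab_mem stab_label)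
    then have "p + swp x (app (- p) x) \<in> ?H" by (auto simp: stab_def)
    then show "(p + swp x (app (- p) x), app (- p) x) \<in> ?H \<times> ?Y"
      using stab_uminus[OF p] X by (auto simp: app_stab_mem stab_label)
  next
    fix z assume z: "z \<in> ?H \<times> ?Y"
    then obtain y h where [simp]: "z = (h, y)" and y: "y \<in> ?Y" "h \<in> ?H" by auto
    have [simp]: "app (- h) x = x" using stab_uminus[OF y(2)] by (auto simp: stab_def)
    show "(case z of (h, y) \<Rightarrow> h + swp x y) \<in> stab X f"
      using y H X by (auto intro!: stab_plus stab_swp)
    show "((case z of (h, y) \<Rightarrow> h + swp x y) + swp x (app (- (case z of (h, y) \<Rightarrow> h + swp x y)) x),
        app (- (case z of (h, y) \<Rightarrow> h + swp x y)) x) = z"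
      by (simp add: minus_add add.assoc del: add_uminus_conv_diff)
  qed (auto simp: add.assoc)
  also have "\<dots> = (\<Sum>h\<in>?H. \<Sum>y\<in>?Y. (of_int (\<epsilon> h) * gelem h) * (of_int (\<epsilon> (swp x y)) * gelem (swp x y)))"
    unfolding sum.cartesian_product using \<epsilon>
    by (intro sum.cong) (auto simp only: perm_character_def scaled_gelem_mult)
  finally show ?thesis by (simp add: stab_sum_def sum_product)
qed

lemma stab_empty: "stab {} f = {0}"
  by (auto simp: stab_def intro: fperm_eqI)

lemma stab_sum_empty: "perm_character \<epsilon> \<Longrightarrow> stab_sum \<epsilon> {} f = 1"
  by (simp add: stab_sum_def stab_empty perm_character_zero)

text \<open>Elements of \<open>A\<close> are split off one at a time. As no label of
  \<open>A\<close> occurs in \<open>B\<close>, the coset representatives for \<open>x\<close> are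
  the same in \<open>A \<union> B\<close> as in \<open>A\<close>.\<close>

lemma stab_sum_union:
  assumes "perm_character \<epsilon>" "finite A" "finite B" "\<And>x y. x \<in> A \<Longrightarrow> y \<in> B \<Longrightarrow> f x \<noteq> f y"
  shows "stab_sum \<epsilon> (A \<union> B) f = stab_sum \<epsilon> A f * stab_sum \<epsilon> B f"
  using assms(2,4)
proof (induction A rule: finite_induct)
  case empty
  then show ?case using assms(1) by (simp add: stab_sum_empty)
next
  case (insert x A)
  let ?s = "\<Sum>y | y \<in> insert x A \<and> f y = f x. of_int (\<epsilon> (swp x y)) * gelem (swp x y)"
  have x: "insert x A \<union> B - {x} = A \<union> B" "insert x A - {x} = A" using insert by auto
  have "stab_sum \<epsilon> (insert x A \<union> B) f =
      (\<Sum>y | y \<in> insert x A \<union> B \<and> f y = f x. of_int (\<epsilon> (swp x y)) * gelem (swp x y)) * stab_sum \<epsilon> (A \<union> B) f"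
    using stab_sum_insert_left[OF assms(1), of "insert x A \<union> B" x f] insert(1) assms(3)
    unfolding x by simp
  also have "{y \<in> insert x A \<union> B. f y = f x} = {y \<in> insert x A. f y = f x}"
    using insert.prems[of x] by fastforce
  also have "?s * stab_sum \<epsilon> (A \<union> B) f = (?s * stab_sum \<epsilon> A f) * stab_sum \<epsilon> B f"
    using insert by (simp add: mult.assoc)
  also have "?s * stab_sum \<epsilon> A f = stab_sum \<epsilon> (insert x A) f"
    using stab_sum_insert_left[OF assms(1), of "insert x A" x f] insert(1) by (simp add: x)
  finally show ?case .
qed

lemma stab_disjoint_commute:
  assumes "p \<in> stab A f" "q \<in> stab B g" "A \<inter> B = {}"
  shows "p + q = q + p"
proof (rule fperm_eqI)
  fix x
  consider "x \<in> A" "x \<notin> B" | "x \<in> B" "x \<notin> A" | "x \<notin> A" "x \<notin> B" using assms(3) by blast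
  then show "app (p + q) x = app (q + p) x"
  proof cases
    case 1
    then have "app p x \<notin> B" using app_stab_mem[OF assms(1)] assms(3) by blast
    then show ?thesis using 1 stab_fix[OF assms(2)] by simp
  next
    case 2
    then have "app q x \<notin> A" using app_stab_mem[OF assms(2)] assms(3) by blast
    then show ?thesis using 2 stab_fix[OF assms(1)] by simp
  next
    case 3
    then show ?thesis using stab_fix[OF assms(1)] stab_fix[OF assms(2)] by simp
  qed
qed

lemma gelem_stab_sum_commute:
  assumes "p \<in> stab A f" "A \<inter> B = {}"
  shows "gelem p * stab_sum \<epsilon> B g = stab_sum \<epsilon> B g * gelem p"
proof -
  have "gelem p * gelem q = gelem q * gelem p" if "q \<in> stab B g" for q
    using stab_disjoint_commute[OF assms(1) that assms(2)] by (simp flip: gelem_plus)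
  then show ?thesis
    unfolding stab_sum_def sum_distrib_left sum_distrib_right
    by (intro sum.cong) (auto simp only: mult_of_int_left_commute mult.assoc)
qed

lemma stab_sum_commute:
  assumes "A \<inter> B = {}"
  shows "stab_sum \<epsilon> A f * stab_sum \<delta> B g = stab_sum \<delta> B g * stab_sum \<epsilon> A f"
proof -
  have "stab_sum \<epsilon> A f * stab_sum \<delta> B g = (\<Sum>p\<in>stab A f. of_int (\<epsilon> p) * (gelem p * stab_sum \<delta> B g))"
    unfolding stab_sum_def[of \<epsilon>] sum_distrib_right by (simp add: mult.assoc)
  also have "\<dots> = (\<Sum>p\<in>stab A f. of_int (\<epsilon> p) * (stab_sum \<delta> B g * gelem p))"
    by (intro sum.cong refl arg_cong2[of _ _ _ _ "(*)"] gelem_stab_sum_commute[OF _ assms])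
  also have "\<dots> = stab_sum \<delta> B g * stab_sum \<epsilon> A f"
    unfolding stab_sum_def[of \<epsilon>] sum_distrib_left by (simp add: mult_of_int_left_commute)
  finally show ?thesis .
qed

section \<open>Sums over full symmetric groups: conjugation, absorption, vanishing\<close>

abbreviation full_sum :: "('a fperm \<Rightarrow> int) \<Rightarrow> 'a set \<Rightarrow> 'a group_ring" where
  "full_sum \<epsilon> Y \<equiv> stab_sum \<epsilon> Y (\<lambda>_. ())"

text \<open>Conjugation by \<open>q\<close> carries the symmetric group on \<open>Y\<close> to that
  on its image, and a character with commuting values does not see the conjugation.\<close>

lemma gelem_mult_full_sum:
  assumes "perm_character \<epsilon>"
  shows "gelem q * full_sum \<epsilon> Y = full_sum \<epsilon> (app q ` Y) * gelem q"
proof -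
  have plus: "\<epsilon> (a + b) = \<epsilon> a * \<epsilon> b" for a b
    using assms by (simp add: perm_character_def)
  have "\<epsilon> (- q) * \<epsilon> q = 1"
    using perm_character_zero[OF assms] by (metis plus add.left_inverse)
  then have conj: "\<epsilon> (q + p + - q) = \<epsilon> p" for p
    unfolding plus by (metis mult.commute mult.left_commute mult_1)
  have "gelem q * full_sum \<epsilon> Y = (\<Sum>p\<in>stab Y (\<lambda>_. ()). of_int (\<epsilon> p) * gelem (q + p))"
    unfolding stab_sum_def sum_distrib_left by (simp add: mult_of_int_left_commute mult_single)
  also have "\<dots> = (\<Sum>p\<in>stab (app q ` Y) (\<lambda>_. ()). of_int (\<epsilon> p) * gelem (p + q))"
  proof (rule sum.reindex_bij_witness[of _ "\<lambda>p. - q + p + q" "\<lambda>p. q + p + - q"])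
    fix p assume p: "p \<in> stab (app q ` Y) (\<lambda>_. ())"
    have "app (- q + p + q) x = x" if "x \<notin> Y" for x
    proof -
      have "app q x \<notin> app q ` Y" using that by auto
      then show ?thesis using stab_fix[OF p] by simp
    qed
    then show "- q + p + q \<in> stab Y (\<lambda>_. ())" by (auto simp: stab_def)
  next
    fix p assume p: "p \<in> stab Y (\<lambda>_. ())"
    have "app (q + p + - q) x = x" if "x \<notin> app q ` Y" for x
    proof -
      have "app (- q) x \<notin> Y" using that by (metis app_app_uminus imageI)
      then show ?thesis using stab_fix[OF p] by (simp del: add_uminus_conv_diff)
    qed
    then show "q + p + - q \<in> stab (app q ` Y) (\<lambda>_. ())" by (auto simp: stab_def)
    show "of_int (\<epsilon> (q + p + - q)) * gelem (q + p + - q + q) = of_int (\<epsilon> p) * gelem (q + p)"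
      unfolding conj by (simp add: add.assoc del: add_uminus_conv_diff)
  qed (simp_all add: add.assoc del: add_uminus_conv_diff)
  also have "\<dots> = full_sum \<epsilon> (app q ` Y) * gelem q"
    unfolding stab_sum_def sum_distrib_right by (simp add: mult.assoc mult_single)
  finally show ?thesis .
qed

lemma mult_stab_sum_absorb:
  assumes "perm_character \<epsilon>" "\<And>p. p \<in> stab Y f \<Longrightarrow> x * gelem p = of_int (\<epsilon> p) * x"
  shows "x * stab_sum \<epsilon> Y f = of_nat (card (stab Y f)) * x"
proof -
  have "x * stab_sum \<epsilon> Y f = (\<Sum>p\<in>stab Y f. of_int (\<epsilon> p) * (x * gelem p))"
    unfolding stab_sum_def sum_distrib_left by (simp add: mult_of_int_left_commute)
  also have "\<dots> = (\<Sum>p\<in>stab Y f. x)"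
  proof (rule sum.cong)
    fix p assume "p \<in> stab Y f"
    then have "of_int (\<epsilon> p) * (x * gelem p) = of_int (\<epsilon> p * \<epsilon> p) * x"
      by (simp add: assms(2) mult.assoc)
    then show "of_int (\<epsilon> p) * (x * gelem p) = x" using assms(1) by (simp add: perm_character_def del: of_int_mult)
  qed simp
  finally show ?thesis by simp
qed

lemma stab_sum_mult_absorb:
  assumes "perm_character \<epsilon>" "\<And>p. p \<in> stab Y f \<Longrightarrow> gelem p * x = of_int (\<epsilon> p) * x"
  shows "stab_sum \<epsilon> Y f * x = of_nat (card (stab Y f)) * x"
proof -
  have "stab_sum \<epsilon> Y f * x = (\<Sum>p\<in>stab Y f. of_int (\<epsilon> p) * (gelem p * x))"
    unfolding stab_sum_def sum_distrib_right by (simp add: mult.assoc)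
  also have "\<dots> = (\<Sum>p\<in>stab Y f. x)"
  proof (rule sum.cong)
    fix p assume "p \<in> stab Y f"
    then have "of_int (\<epsilon> p) * (gelem p * x) = of_int (\<epsilon> p * \<epsilon> p) * x"
      by (simp add: assms(2) mult.assoc)
    then show "of_int (\<epsilon> p) * (gelem p * x) = x" using assms(1) by (simp add: perm_character_def del: of_int_mult)
  qed simp
  finally show ?thesis by simp
qed

text \<open>The left factor absorbs a transposition that changes the sign of the alternating sum, so
  the product is its own negative and vanishes, the ring being torsion-free.\<close>

lemma mult_alternating_sum_eq_0:
  assumes "u \<in> Z" "v \<in> Z" "u \<noteq> v" "x * gelem (swp u v) = x"
  shows "x * full_sum sgnp Z = 0"
proof -
  have "gelem (swp u v) * full_sum sgnp Z = - full_sum sgnp Z"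
    using gelem_mult_stab_sum[OF perm_character_sgnp, of "swp u v" Z "\<lambda>_. ()"] assms
    by (simp add: stab_swp sgnp_swp)
  then have "(x * gelem (swp u v)) * full_sum sgnp Z = - (x * full_sum sgnp Z)"
    by (simp add: mult.assoc)
  then show ?thesis unfolding assms(4) by (rule eq_uminus_imp_zero)
qed

lemma symmetric_sum_mult_eq_0:
  assumes "u \<in> Z" "v \<in> Z" "gelem (swp u v) * x = - x"
  shows "full_sum (\<lambda>_. 1) Z * x = 0"
proof -
  have "full_sum (\<lambda>_. 1) Z * gelem (swp u v) = full_sum (\<lambda>_. 1) Z"
    using stab_sum_mult_gelem[OF perm_character_one, of "swp u v" Z "\<lambda>_. ()"] assms
    by (simp add: stab_swp)
  then have "full_sum (\<lambda>_. 1) Z * x = full_sum (\<lambda>_. 1) Z * (gelem (swp u v) * x)"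
    by (simp flip: mult.assoc)
  then have "full_sum (\<lambda>_. 1) Z * x = - (full_sum (\<lambda>_. 1) Z * x)"
    by (simp add: assms(3))
  then show ?thesis by (rule eq_uminus_imp_zero)
qed

lemma app_uminus: "app (- p) = inv (app p)"
  by transfer simp

lemma mem_stab_iff: "p \<in> stab X f \<longleftrightarrow> app p permutes X \<and> (\<forall>x\<in>X. f (app p x) = f x)"
proof -
  have "app p permutes X \<longleftrightarrow> (\<forall>x. x \<notin> X \<longrightarrow> app p x = x)"
    using bij_app[of p] unfolding permutes_def bij_iff by blast
  then show ?thesis by (simp add: stab_def)
qed

lemma bij_betw_app_stab:
  assumes "finite Y"
  shows "bij_betw app (stab Y (\<lambda>_. ())) {p. p permutes Y}"
proof (rule bij_betwI[where g = Fperm])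
  have *: "app (Fperm p) = p" if "p permutes Y" for p
    using assms that by (intro app_Fperm permutes_imp_permutation)
  show "Fperm \<in> {p. p permutes Y} \<rightarrow> stab Y (\<lambda>_. ())"
    using * by (auto simp: mem_stab_iff)
  show "app (Fperm p) = p" if "p \<in> {p. p permutes Y}" for p
    using * that by auto
qed (auto simp: mem_stab_iff app_inverse)

lemma card_stab_full:
  assumes "finite Y"
  shows "card (stab Y (\<lambda>_. ())) = fact (card Y)"
  using bij_betw_same_card[OF bij_betw_app_stab[OF assms]] card_permutations[OF refl assms] by simp

subsection \<open>Garnir relations\<close>

text \<open>A tableau of shape \<open>lam\<close> with entries in an arbitrary set \<open>X\<close>,
  recorded by the row and the column of each entry.\<close>

locale labelled_diagram =
  fixes X :: "'a set" and rw cl :: "'a \<Rightarrow> nat" and lam :: "nat list"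
  assumes sorted: "sorted_wrt (\<ge>) lam"
    and bij: "bij_betw (\<lambda>x. (rw x, cl x)) X (diagram lam)"
begin

lemma diagram_down:
  assumes "(i, j) \<in> diagram lam" "i' \<le> i" "j' \<le> j"
  shows "(i', j') \<in> diagram lam"
proof -
  have "lam ! i \<le> lam ! i'"
    using assms sorted by (cases "i' = i") (auto simp: diagram_def sorted_wrt_iff_nth_less)
  then show ?thesis using assms by (auto simp: diagram_def)
qed

lemma finite_X: "finite X"
  using bij bij_betw_finite finite_diagram by blast

lemma label_mem: "x \<in> X \<Longrightarrow> (rw x, cl x) \<in> diagram lam"
  using bij by (auto simp: bij_betw_def)

lemma label_inj: "x \<in> X \<Longrightarrow> y \<in> X \<Longrightarrow> rw x = rw y \<Longrightarrow> cl x = cl y \<Longrightarrow> x = y"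
  using bij by (auto simp: bij_betw_def inj_on_def)

definition cell :: "nat \<Rightarrow> nat \<Rightarrow> 'a" where
  "cell i j = inv_into X (\<lambda>x. (rw x, cl x)) (i, j)"

lemma cell:
  assumes "(i, j) \<in> diagram lam"
  shows "cell i j \<in> X" "rw (cell i j) = i" "cl (cell i j) = j"
proof -
  have "(i, j) \<in> (\<lambda>x. (rw x, cl x)) ` X" using assms bij by (simp add: bij_betw_def)
  from inv_into_into[OF this] f_inv_into_f[OF this]
  show "cell i j \<in> X" "rw (cell i j) = i" "cl (cell i j) = j" by (auto simp: cell_def)
qed

lemma cell_label: "x \<in> X \<Longrightarrow> cell (rw x) (cl x) = x"
  using cell[OF label_mem] label_inj by blast

text \<open>The tableau without its first \<open>s\<close> columns. The induction on columns runs
  through these subsets of one fixed tableau, so no truncated partition has to be formed.\<close>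

definition cells :: "nat \<Rightarrow> 'a set" where
  "cells s = {x \<in> X. s \<le> cl x}"

definition col :: "nat \<Rightarrow> 'a set" where
  "col s = {x \<in> X. cl x = s}"

definition row_sum :: "nat \<Rightarrow> 'a group_ring" where
  "row_sum s = stab_sum (\<lambda>_. 1) (cells s) rw"

definition column_sum :: "nat \<Rightarrow> 'a group_ring" where
  "column_sum s = stab_sum sgnp (cells s) cl"

definition young_sum :: "nat \<Rightarrow> 'a group_ring" where
  "young_sum s = row_sum s * column_sum s"

lemma finite_cells [simp]: "finite (cells s)" and finite_col [simp]: "finite (col s)"
  using finite_X by (auto simp: cells_def col_def)

lemma cells_Suc: "cells s = col s \<union> cells (Suc s)"
  by (auto simp: cells_def col_def)

lemma row_sum_swp:
  assumes "x \<in> cells s" "y \<in> cells s" "rw x = rw y"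
  shows "gelem (swp x y) * row_sum s = row_sum s" "row_sum s * gelem (swp x y) = row_sum s"
  using gelem_mult_stab_sum[OF perm_character_one stab_swp[of x "cells s" y rw]]
    stab_sum_mult_gelem[OF perm_character_one stab_swp[of x "cells s" y rw]] assms
  by (simp_all add: row_sum_def)

lemma column_sum_swp:
  assumes "x \<in> cells s" "y \<in> cells s" "cl x = cl y" "x \<noteq> y"
  shows "gelem (swp x y) * column_sum s = - column_sum s"
    "column_sum s * gelem (swp x y) = - column_sum s"
  using gelem_mult_stab_sum[OF perm_character_sgnp stab_swp[of x "cells s" y cl]]
    stab_sum_mult_gelem[OF perm_character_sgnp stab_swp[of x "cells s" y cl]] assms
  by (simp_all add: column_sum_def sgnp_swp)

lemma column_sum_Suc:
  "column_sum s = full_sum sgnp (col s) * column_sum (Suc s)"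
  "column_sum s = column_sum (Suc s) * full_sum sgnp (col s)"
proof -
  have "stab (col s) cl = stab (col s) (\<lambda>_. ())"
  proof
    show "stab (col s) cl \<subseteq> stab (col s) (\<lambda>_. ())" by (rule stab_mono) auto
    show "stab (col s) (\<lambda>_. ()) \<subseteq> stab (col s) cl" by (rule stab_mono) (auto simp: col_def)
  qed
  then have "full_sum sgnp (col s) = stab_sum sgnp (col s) cl" by (simp add: stab_sum_def)
  moreover have "column_sum s = stab_sum sgnp (col s) cl * column_sum (Suc s)"
    unfolding column_sum_def cells_Suc[of s]
    by (rule stab_sum_union[OF perm_character_sgnp]) (auto simp: col_def cells_def finite_X)
  moreover have "col s \<inter> cells (Suc s) = {}" by (auto simp: col_def cells_def)
  ultimately show "column_sum s = full_sum sgnp (col s) * column_sum (Suc s)"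
    "column_sum s = column_sum (Suc s) * full_sum sgnp (col s)"
    by (simp_all add: column_sum_def stab_sum_commute[of _ "cells (Suc s)"])
qed

text \<open>Expand the column sum. Moving a column permutation \<open>q\<close> past the alternating
  sum replaces \<open>Y\<close> by its image under \<open>q\<close>; there two entries share a row,
  and \<open>row_sum s\<close> absorbs their transposition.\<close>

lemma mult_column_sum_eq_0:
  assumes "\<And>q. q \<in> stab (cells s) cl \<Longrightarrow> \<exists>u v. u \<in> app q ` Y \<and> v \<in> app q ` Y \<and> u \<noteq> v \<and>
      u \<in> cells s \<and> v \<in> cells s \<and> rw u = rw v"
  shows "young_sum s * full_sum sgnp Y = 0"
proof -
  have "row_sum s * (gelem q * full_sum sgnp Y) = 0" if q: "q \<in> stab (cells s) cl" for q
  proof -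
    obtain u v where "u \<in> app q ` Y" "v \<in> app q ` Y" "u \<noteq> v" "u \<in> cells s" "v \<in> cells s" "rw u = rw v"
      using assms[OF q] by blast
    then have "row_sum s * full_sum sgnp (app q ` Y) = 0"
      using mult_alternating_sum_eq_0 row_sum_swp(2) by metis
    then show ?thesis
      by (simp add: gelem_mult_full_sum[OF perm_character_sgnp] flip: mult.assoc)
  qed
  then have "row_sum s * (of_int (sgnp q) * gelem q) * full_sum sgnp Y = 0" if "q \<in> stab (cells s) cl" for q
    using that by (simp add: mult_of_int_left_commute mult.assoc)
  then show ?thesis
    by (simp add: young_sum_def column_sum_def stab_sum_def[of _ "cells s"] sum_distrib_left sum_distrib_right)
qed

text \<open>The mirror image of \<open>mult_column_sum_eq_0\<close>. The symmetric sum now moves to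
  the right past \<open>q\<close>, so \<open>Y\<close> is moved by the inverse of \<open>q\<close>,
  which is again a row permutation.\<close>

lemma row_sum_mult_eq_0:
  assumes "\<And>q. q \<in> stab (cells s) rw \<Longrightarrow> \<exists>u v. u \<in> app q ` Y \<and> v \<in> app q ` Y \<and> u \<noteq> v \<and>
      u \<in> cells s \<and> v \<in> cells s \<and> cl u = cl v"
  shows "full_sum (\<lambda>_. 1) Y * young_sum s = 0"
proof -
  have "full_sum (\<lambda>_. 1) Y * gelem q * column_sum s = 0" if q: "q \<in> stab (cells s) rw" for q
  proof -
    obtain u v where uv: "u \<in> app (- q) ` Y" "v \<in> app (- q) ` Y" "u \<noteq> v" "u \<in> cells s" "v \<in> cells s" "cl u = cl v"
      using assms[OF stab_uminus[OF q]] by blast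
    then have z: "full_sum (\<lambda>_. 1) (app (- q) ` Y) * column_sum s = 0"
      using symmetric_sum_mult_eq_0 column_sum_swp(1) by metis
    have "app q ` app (- q) ` Y = Y" by (simp add: image_image)
    then have "full_sum (\<lambda>_. 1) Y * gelem q = gelem q * full_sum (\<lambda>_. 1) (app (- q) ` Y)"
      by (simp add: gelem_mult_full_sum[OF perm_character_one])
    then show ?thesis using z by (simp add: mult.assoc)
  qed
  then show ?thesis
    by (simp add: young_sum_def row_sum_def stab_sum_def[of _ "cells s"] sum_distrib_left sum_distrib_right
        mult.assoc)
qed

lemma young_sum_absorb_right:
  assumes "p \<in> stab (cells s) cl"
  shows "young_sum s * gelem p = of_int (sgnp p) * young_sum s"
  unfolding young_sum_def column_sum_def
  by (simp add: mult.assoc stab_sum_mult_gelem[OF perm_character_sgnp assms] mult_of_int_left_commute)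

lemma young_sum_absorb_left:
  assumes "p \<in> stab (cells s) rw"
  shows "gelem p * young_sum s = young_sum s"
  unfolding young_sum_def row_sum_def
  using gelem_mult_stab_sum[OF perm_character_one assms] by (simp flip: mult.assoc)

lemma card_stab_nz: "finite Y \<Longrightarrow> card (stab Y f) \<noteq> 0"
  by (metis card_eq_0_iff empty_iff stab_zero finite_stab)

text \<open>The Garnir relation for column \<open>s\<close> together with one entry \<open>z\<close>
  to its right. No column on the right is longer than column \<open>s\<close>, so the alternating
  sum over these entries is killed. Its coset expansion is the alternating sum of the column, which
  acts on \<open>young_sum s\<close> as the order of its group, times 1 minus the transpositions;
  the order cancels.\<close>

lemma young_sum_garnir:
  assumes z: "z \<in> cells (Suc s)"
  shows "young_sum s * (\<Sum>x\<in>col s. gelem (swp x z)) = young_sum s"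
proof -
  let ?Y = "insert z (col s)" and ?B = "full_sum sgnp (col s)" and ?S = "\<Sum>x\<in>col s. gelem (swp x z)"
  have zc: "z \<notin> col s" using z by (auto simp: cells_def col_def)
  have colc: "col s \<subseteq> cells s" "z \<in> cells s" using z by (auto simp: cells_def col_def)
  have zero: "young_sum s * full_sum sgnp ?Y = 0"
  proof (rule mult_column_sum_eq_0)
    fix q assume q: "q \<in> stab (cells s) cl"
    define v where "v = app q z"
    have v: "v \<in> cells s" "cl v = cl z" using q colc by (auto simp: v_def app_stab_mem stab_label)
    \<comment> \<open>The entry of column \<open>s\<close> in the row of the moved \<open>z\<close>,
      present because the diagram is closed to the left. As \<open>q\<close> preserves column
      \<open>s\<close>, this entry also lies in the image of the column.\<close>
    define w where "w = cell (rw v) s"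
    have d: "(rw v, s) \<in> diagram lam"
      using v z by (intro diagram_down[OF label_mem[of v]]) (auto simp: cells_def)
    then have w: "w \<in> col s" "rw w = rw v" "w \<in> X" using cell[OF d] by (auto simp: w_def col_def)
    have "app (- q) w \<in> X" using app_stab_mem[OF stab_uminus[OF q], of w] w by (auto simp: cells_def col_def)
    moreover have "cl (app (- q) w) = s" using stab_label[OF stab_uminus[OF q]] w by (auto simp: col_def)
    ultimately have "app (- q) w \<in> col s" by (simp add: col_def)
    then have "w \<in> app q ` ?Y" by (intro image_eqI[of _ _ "app (- q) w"]) auto
    moreover have "w \<noteq> v" using w v z by (auto simp: col_def cells_def)
    ultimately show "\<exists>u v. u \<in> app q ` ?Y \<and> v \<in> app q ` ?Y \<and> u \<noteq> v \<and>
        u \<in> cells s \<and> v \<in> cells s \<and> rw u = rw v"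
      using w v colc by (intro exI[of _ w] exI[of _ v]) (auto simp: v_def)
  qed
  have "full_sum sgnp ?Y = ?B * (\<Sum>y | y \<in> ?Y \<and> () = (). of_int (sgnp (swp z y)) * gelem (swp z y))"
    using stab_sum_insert_right[OF perm_character_sgnp, of ?Y z "\<lambda>_. ()"] zc by simp
  also have "(\<Sum>y | y \<in> ?Y \<and> () = (). of_int (sgnp (swp z y)) * gelem (swp z y))
      = 1 + (\<Sum>y\<in>col s. - gelem (swp y z))"
  proof -
    have "{y. y \<in> ?Y \<and> () = ()} = ?Y" by auto
    moreover have "(\<Sum>y\<in>col s. of_int (sgnp (swp z y)) * gelem (swp z y)) = (\<Sum>y\<in>col s. - gelem (swp y z))"
    proof (rule sum.cong)
      fix y assume "y \<in> col s"
      then have "y \<noteq> z" using zc by auto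
      then show "of_int (sgnp (swp z y)) * gelem (swp z y) = - gelem (swp y z)"
        by (simp add: sgnp_swp swp_commute[of z])
    qed simp
    ultimately show ?thesis using zc by simp
  qed
  finally have Y: "full_sum sgnp ?Y = ?B * (1 - ?S)" by (simp add: sum_negf)
  have B: "young_sum s * ?B = of_nat (card (stab (col s) (\<lambda>_. ()))) * young_sum s"
  proof (rule mult_stab_sum_absorb[OF perm_character_sgnp])
    fix p assume "p \<in> stab (col s) (\<lambda>_. ())"
    moreover have "stab (col s) (\<lambda>_. ()) \<subseteq> stab (cells s) cl"
      by (rule stab_mono) (auto simp: col_def cells_def)
    ultimately show "young_sum s * gelem p = of_int (sgnp p) * young_sum s"
      by (intro young_sum_absorb_right) auto
  qed
  have "of_nat (card (stab (col s) (\<lambda>_. ()))) * young_sum s * (1 - ?S) = 0"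
    using zero unfolding Y mult.assoc[symmetric] B .
  then have "of_nat (card (stab (col s) (\<lambda>_. ()))) * (young_sum s * (1 - ?S))
      = of_nat (card (stab (col s) (\<lambda>_. ()))) * 0"
    by (simp only: mult.assoc mult_zero_right)
  then have "young_sum s * (1 - ?S) = 0"
    by (rule of_nat_mult_cancel) (simp add: card_stab_nz)
  then show ?thesis by (simp add: right_diff_distrib)
qed

text \<open>The dual relation, for row \<open>i\<close> and one entry \<open>z\<close> below it: the
  column of a moved \<open>z\<close> still has an entry in row \<open>i\<close>, so the symmetric
  sum over the row and \<open>z\<close> is killed by the column sum. There are no signs in the coset
  expansion, hence the minus sign on the right.\<close>

lemma garnir_young_sum:
  assumes z: "z \<in> cells s" and i: "i < rw z"
  shows "(\<Sum>y | y \<in> cells s \<and> rw y = i. gelem (swp y z)) * young_sum s = - young_sum s"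
proof -
  let ?r = "{y \<in> cells s. rw y = i}"
  let ?Y = "insert z ?r" and ?B = "full_sum (\<lambda>_. 1) ?r" and ?S = "\<Sum>x\<in>?r. gelem (swp x z)"
  have zc: "z \<notin> ?r" using i by auto
  have zero: "full_sum (\<lambda>_. 1) ?Y * young_sum s = 0"
  proof (rule row_sum_mult_eq_0)
    fix q assume q: "q \<in> stab (cells s) rw"
    define v where "v = app q z"
    have v: "v \<in> cells s" "rw v = rw z" using q z by (auto simp: v_def app_stab_mem stab_label)
    define w where "w = cell i (cl v)"
    have d: "(i, cl v) \<in> diagram lam"
      using v i by (intro diagram_down[OF label_mem[of v]]) (auto simp: cells_def)
    then have w: "w \<in> ?r" "cl w = cl v" using cell[OF d] v by (auto simp: w_def cells_def)
    have "app (- q) w \<in> ?r"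
      using w stab_uminus[OF q] by (simp add: app_stab_mem stab_label)
    then have "w \<in> app q ` ?Y" by (intro image_eqI[of _ _ "app (- q) w"]) auto
    moreover have "w \<noteq> v" using w v i by auto
    ultimately show "\<exists>u v. u \<in> app q ` ?Y \<and> v \<in> app q ` ?Y \<and> u \<noteq> v \<and>
        u \<in> cells s \<and> v \<in> cells s \<and> cl u = cl v"
      using w v by (intro exI[of _ w] exI[of _ v]) (auto simp: v_def)
  qed
  have "full_sum (\<lambda>_. 1) ?Y = (\<Sum>y | y \<in> ?Y \<and> () = (). of_int 1 * gelem (swp z y)) * ?B"
    using stab_sum_insert_left[OF perm_character_one, of ?Y z "\<lambda>_. ()"] zc by simp
  also have "(\<Sum>y | y \<in> ?Y \<and> () = (). of_int 1 * gelem (swp z y)) = 1 + ?S"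
  proof -
    have "{y. y \<in> ?Y \<and> () = ()} = ?Y" by auto
    moreover have "(\<Sum>y\<in>?r. of_int 1 * gelem (swp z y)) = ?S"
      by (intro sum.cong) (simp_all add: swp_commute[of z])
    ultimately show ?thesis using zc by simp
  qed
  finally have Y: "full_sum (\<lambda>_. 1) ?Y = (1 + ?S) * ?B" .
  have B: "?B * young_sum s = of_nat (card (stab ?r (\<lambda>_. ()))) * young_sum s"
  proof (rule stab_sum_mult_absorb[OF perm_character_one])
    fix p assume "p \<in> stab ?r (\<lambda>_. ())"
    moreover have "stab ?r (\<lambda>_. ()) \<subseteq> stab (cells s) rw" by (rule stab_mono) auto
    ultimately show "gelem p * young_sum s = of_int 1 * young_sum s"
      using young_sum_absorb_left by auto
  qed
  have "(1 + ?S) * (of_nat (card (stab ?r (\<lambda>_. ()))) * young_sum s) = 0"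
    using zero unfolding Y mult.assoc B .
  then have "of_nat (card (stab ?r (\<lambda>_. ()))) * ((1 + ?S) * young_sum s)
      = of_nat (card (stab ?r (\<lambda>_. ()))) * 0"
    using mult_of_int_left_commute[of "1 + ?S" "int (card (stab ?r (\<lambda>_. ())))" "young_sum s"] by simp
  then have "(1 + ?S) * young_sum s = 0"
    by (rule of_nat_mult_cancel) (simp add: card_stab_nz)
  then show ?thesis by (simp add: distrib_right eq_neg_iff_add_eq_0 add.commute)
qed

end

subsection \<open>The hook length formula\<close>

lemma down_closed_eq_lessThan:
  fixes D :: "nat set"
  assumes "finite D" "\<And>i j. i \<in> D \<Longrightarrow> j \<le> i \<Longrightarrow> j \<in> D"
  shows "D = {..<card D}"
proof (cases "D = {}")
  case False
  have "D = {..Max D}"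
  proof
    show "D \<subseteq> {..Max D}" using assms(1) by auto
    show "{..Max D} \<subseteq> D" using assms(2)[OF Max_in[OF assms(1) False]] by auto
  qed
  then show ?thesis by (metis card_atMost lessThan_Suc_atMost)
qed auto

lemma of_nat_left_commute: "of_nat m * (of_nat n * x) = of_nat n * (of_nat m * (x :: 'b::ring_1))"
  by (simp flip: mult.assoc of_nat_mult add: mult.commute)

context labelled_diagram
begin

definition height :: "nat \<Rightarrow> nat" where
  "height s = card (col s)"

definition arm :: "nat \<Rightarrow> nat \<Rightarrow> 'a set" where
  "arm s i = {y \<in> cells (Suc s). rw y = i}"

lemma finite_arm [simp]: "finite (arm s i)"
  by (simp add: arm_def)

lemma col_rows: "bij_betw rw (col s) {i. (i, s) \<in> diagram lam}"
proof (rule bij_betwI[where g = "\<lambda>i. cell i s"])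
  show "rw \<in> col s \<rightarrow> {i. (i, s) \<in> diagram lam}" using label_mem by (auto simp: col_def)
  show "(\<lambda>i. cell i s) \<in> {i. (i, s) \<in> diagram lam} \<rightarrow> col s" using cell by (auto simp: col_def)
  show "cell (rw x) s = x" if "x \<in> col s" for x using that cell_label by (auto simp: col_def)
  show "rw (cell i s) = i" if "i \<in> {i. (i, s) \<in> diagram lam}" for i using that cell by auto
qed

lemma column_eq_lessThan: "{i. (i, s) \<in> diagram lam} = {..<height s}"
proof -
  have "finite {i. (i, s) \<in> diagram lam}" using col_rows bij_betw_finite finite_col by blast
  moreover have "card {i. (i, s) \<in> diagram lam} = height s"
    using bij_betw_same_card[OF col_rows] by (simp add: height_def)
  ultimately show ?thesis
    using down_closed_eq_lessThan[of "{i. (i, s) \<in> diagram lam}"] diagram_down by auto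
qed

lemma diagram_iff: "(i, s) \<in> diagram lam \<longleftrightarrow> i < height s"
  using column_eq_lessThan[of s] by blast

lemma cell_col: "i < height s \<Longrightarrow> cell i s \<in> col s" "i < height s \<Longrightarrow> rw (cell i s) = i"
  using cell[of i s] by (auto simp: diagram_iff col_def)

lemma sum_col: "(\<Sum>x\<in>col s. g x) = (\<Sum>i<height s. g (cell i s))"
proof -
  have "bij_betw (\<lambda>i. cell i s) {..<height s} (col s)"
    by (rule bij_betwI[where g = rw]) (use cell_col cell_label label_mem diagram_iff in \<open>auto simp: col_def\<close>)
  then show ?thesis by (metis sum.reindex_bij_betw)
qed

lemma col_cells_disjoint: "col s \<inter> cells (Suc s) = {}"
  by (auto simp: col_def cells_def)

lemma cell_neq_arm: "l < height s \<Longrightarrow> y \<in> arm s j \<Longrightarrow> cell l s \<noteq> y"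
  using cell_col(1)[of l s] col_cells_disjoint[of s] by (auto simp: arm_def)

section \<open>Splitting the row sum along one column\<close>

definition row_step :: "nat \<Rightarrow> nat \<Rightarrow> 'a group_ring" where
  "row_step s i = (\<Sum>y\<in>arm s i. gelem (swp (cell i s) y))"

primrec row_prefix :: "nat \<Rightarrow> nat \<Rightarrow> 'a group_ring" where
  "row_prefix s 0 = 1"
| "row_prefix s (Suc i) = row_prefix s i * (1 + row_step s i)"

text \<open>The cells of column \<open>s\<close> are split off from top to bottom. At
  \<open>cell i s\<close> the coset representatives are the identity and the transpositions with the
  arm of that cell, since column \<open>s\<close> has only one cell in row \<open>i\<close>.\<close>

lemma row_sum_prefix:
  "i \<le> height s \<Longrightarrow> row_sum s = row_prefix s i * stab_sum (\<lambda>_. 1) (cells s - (\<lambda>l. cell l s) ` {..<i}) rw"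
proof (induction i)
  case 0
  then show ?case by (simp add: row_sum_def)
next
  case (Suc i)
  let ?X = "cells s - (\<lambda>l. cell l s) ` {..<i}"
  have c: "cell i s \<in> col s" "rw (cell i s) = i" using Suc.prems cell_col by auto
  have "cell i s \<in> ?X"
    using c Suc.prems by (auto simp: cells_Suc[of s]) (metis cell_col(2) less_trans nat_neq_iff Suc_le_eq)
  have "stab_sum (\<lambda>_. 1) ?X rw = (\<Sum>y | y \<in> ?X \<and> rw y = rw (cell i s). of_int 1 * gelem (swp (cell i s) y))
      * stab_sum (\<lambda>_. 1) (?X - {cell i s}) rw"
    by (rule stab_sum_insert_left[OF perm_character_one]) (use \<open>cell i s \<in> ?X\<close> in auto)
  moreover have "?X - {cell i s} = cells s - (\<lambda>l. cell l s) ` {..<Suc i}"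
    by (auto simp: lessThan_Suc)
  moreover have "{y. y \<in> ?X \<and> rw y = rw (cell i s)} = insert (cell i s) (arm s i)"
  proof (intro equalityI subsetI)
    fix y assume y: "y \<in> {y. y \<in> ?X \<and> rw y = rw (cell i s)}"
    show "y \<in> insert (cell i s) (arm s i)"
    proof (cases "cl y = s")
      case True
      then have "y = cell i s" using y c label_inj[of y "cell i s"] by (auto simp: cells_def col_def)
      then show ?thesis by simp
    qed (use y c in \<open>auto simp: cells_def arm_def\<close>)
  next
    fix y assume "y \<in> insert (cell i s) (arm s i)"
    moreover have "y \<notin> (\<lambda>l. cell l s) ` {..<i}" if "y \<in> arm s i"
      using that Suc.prems cell_col(2)[of _ s] by (force simp: arm_def)
    ultimately show "y \<in> {y. y \<in> ?X \<and> rw y = rw (cell i s)}"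
      using \<open>cell i s \<in> ?X\<close> c by (auto simp: arm_def cells_def)
  qed
  moreover have "cell i s \<notin> arm s i" using c col_cells_disjoint by (auto simp: arm_def)
  ultimately have "stab_sum (\<lambda>_. 1) ?X rw = (1 + row_step s i) * stab_sum (\<lambda>_. 1) (cells s - (\<lambda>l. cell l s) ` {..<Suc i}) rw"
    by (simp add: row_step_def)
  then show ?case using Suc by (simp add: mult.assoc)
qed

lemma row_sum_Suc: "row_sum s = row_prefix s (height s) * row_sum (Suc s)"
proof -
  have "(\<lambda>l. cell l s) ` {..<height s} = col s"
    using cell_col cell_label label_mem diagram_iff by (force simp: col_def image_iff)
  then have "cells s - (\<lambda>l. cell l s) ` {..<height s} = cells (Suc s)"
    using col_cells_disjoint[of s] cells_Suc[of s] by blast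
  then show ?thesis using row_sum_prefix[of "height s" s] by (simp add: row_sum_def)
qed

text \<open>Describes a product of disjoint transpositions, one for each \<open>l \<in> S\<close>, exchanging the \<open>l\<close>-th
  cell of column \<open>s\<close> with a cell further right in row \<open>l\<close>.\<close>

definition row_shift :: "nat \<Rightarrow> nat \<Rightarrow> nat set \<Rightarrow> 'a fperm \<Rightarrow> bool" where
  "row_shift s i S \<pi> \<longleftrightarrow> S \<subseteq> {i..<height s} \<and>
    (\<forall>l<height s. l \<notin> S \<longrightarrow> app \<pi> (cell l s) = cell l s) \<and>
    (\<forall>l\<in>S. app (- \<pi>) (cell l s) \<in> arm s l) \<and>
    (\<forall>l<i. \<forall>y\<in>arm s l. app \<pi> y = y)"

lemma row_shift_fix:
  assumes "row_shift s i S \<pi>" "l < i" "y \<in> arm s l"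
  shows "app \<pi> y = y" "app (- \<pi>) y = y"
proof -
  show "app \<pi> y = y" using assms unfolding row_shift_def by blast
  then show "app (- \<pi>) y = y" by (simp add: app_uminus_eq_iff)
qed

lemma row_shift_SucD:
  assumes "row_shift s (Suc i) S \<pi>"
  shows "row_shift s i S \<pi>"
proof -
  have "S \<subseteq> {i..<height s}" using assms by (auto simp: row_shift_def)
  moreover have "\<forall>l<i. \<forall>y\<in>arm s l. app \<pi> y = y"
    using row_shift_fix(1)[OF assms] less_SucI by blast
  ultimately show ?thesis using assms unfolding row_shift_def by blast
qed

text \<open>By \<open>young_sum_garnir\<close>, summing \<open>c * gelem (swp (cell l s) y) * gelem \<pi> * Z\<close> over all \<open>l\<close> gives
  \<open>c * gelem \<pi> * Z\<close>. The terms with \<open>l \<notin> S\<close> are equal, by antisymmetry in column \<open>s\<close>; those with \<open>l \<in> S\<close>,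
  summed over \<open>y\<close>, are evaluated by \<open>garnir_young_sum\<close>.\<close>

lemma row_step_shift:
  fixes s
  defines "c \<equiv> young_sum s" and "Z \<equiv> row_sum (Suc s) * column_sum s"
  assumes \<pi>: "row_shift s (Suc i) S \<pi>" and i: "i < height s"
  shows "of_nat (height s - card S) * (c * row_step s i * gelem \<pi> * Z)
    = of_nat (card (arm s i) + card S) * (c * gelem \<pi> * Z)"
proof -
  let ?k = "height s" and ?x = "\<lambda>l. cell l s"
  have S: "S \<subseteq> {..<?k}" "i \<notin> S" "finite S"
    using \<pi> finite_subset[of S "{Suc i..<height s}"] by (auto simp: row_shift_def)
  have colc: "col s \<subseteq> cells s" by (auto simp: col_def cells_def)
  have notin: "c * gelem (swp (?x l) y) * gelem \<pi> * Z = c * gelem (swp (?x i) y) * gelem \<pi> * Z"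
    if l: "l < ?k" "l \<notin> S" and y: "y \<in> arm s i" for l y
  proof (cases "l = i")
    case False
    define t where "t = swp (?x i) (?x l)"
    have ne: "?x i \<noteq> ?x l" using False cell_col(2) l i by metis
    have y': "y \<noteq> ?x i" "y \<noteq> ?x l" using cell_neq_arm[OF _ y, of i] cell_neq_arm[OF l(1) y] i by auto
    have "t + swp (?x i) y = swp (?x l) y + t"
      unfolding add_swp using y' by (simp add: t_def)
    then have 1: "swp (?x l) y = t + swp (?x i) y + t" by (simp add: t_def add.assoc)
    \<comment> \<open>Neither \<open>i\<close> nor \<open>l\<close> is in \<open>S\<close>, so
      \<open>\<pi>\<close> fixes both cells exchanged by \<open>t\<close>.\<close>
    have "\<pi> + t = t + \<pi>"
      unfolding t_def add_swp using \<pi> l i S by (auto simp: row_shift_def)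
    then have 2: "gelem t * gelem \<pi> = gelem \<pi> * gelem t" by (simp flip: gelem_plus)
    have xs: "?x i \<in> cells s" "?x l \<in> cells s" "cl (?x i) = cl (?x l)"
      using cell_col(1)[OF i] cell_col(1)[OF l(1)] colc by (auto simp: col_def)
    have 3: "c * gelem t = - c"
      using column_sum_swp(2)[OF xs ne] by (simp add: c_def young_sum_def t_def mult.assoc)
    have "t \<in> stab (col s) (\<lambda>_. ())"
      using cell_col(1)[OF i] cell_col(1)[OF l(1)] by (auto simp: t_def stab_swp)
    then have "gelem t * row_sum (Suc s) = row_sum (Suc s) * gelem t"
      unfolding row_sum_def by (rule gelem_stab_sum_commute[OF _ col_cells_disjoint])
    then have 4: "gelem t * Z = - Z"
      using column_sum_swp(1)[OF xs ne] by (simp add: Z_def t_def flip: mult.assoc) (simp add: mult.assoc)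
    have "c * gelem (swp (?x l) y) * gelem \<pi> * Z
        = (c * gelem t) * gelem (swp (?x i) y) * (gelem t * gelem \<pi>) * Z"
      unfolding 1 gelem_plus by (simp only: mult.assoc)
    also have "\<dots> = (c * gelem t) * gelem (swp (?x i) y) * gelem \<pi> * (gelem t * Z)"
      unfolding 2 by (simp only: mult.assoc)
    also have "\<dots> = c * gelem (swp (?x i) y) * gelem \<pi> * Z"
      unfolding 3 4 by simp
    finally show ?thesis .
  qed simp
  have mem: "(\<Sum>y\<in>arm s i. c * gelem (swp (?x l) y) * gelem \<pi> * Z) = - (c * gelem \<pi> * Z)"
    if l: "l \<in> S" for l
  proof -
    \<comment> \<open>The entry of row \<open>l\<close> that \<open>\<pi>\<close> carries to
      \<open>cell l s\<close>. It lies to the right of column \<open>s\<close> and below row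
      \<open>i\<close>, because \<open>S\<close> starts at \<open>Suc i\<close>; so the dual Garnir
      relation for the arm of row \<open>i\<close> applies to it.\<close>
    define z where "z = app (- \<pi>) (?x l)"
    have z: "z \<in> cells (Suc s)" "i < rw z" using \<pi> l by (auto simp: row_shift_def arm_def z_def)
    have "gelem (swp (?x l) y) * gelem \<pi> = gelem \<pi> * gelem (swp y z)" if "y \<in> arm s i" for y
    proof -
      have "app (- \<pi>) y = y" by (rule row_shift_fix(2)[OF \<pi> _ that]) simp
      then have "swp (?x l) y + \<pi> = \<pi> + swp y z"
        unfolding swp_add by (simp add: z_def swp_commute[of _ y])
      then show ?thesis by (simp flip: gelem_plus)
    qed
    then have "(\<Sum>y\<in>arm s i. c * gelem (swp (?x l) y) * gelem \<pi> * Z) = (\<Sum>y\<in>arm s i. c * gelem \<pi> * (gelem (swp y z) * Z))"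
      by (intro sum.cong refl) (simp only: mult.assoc)
    also have "\<dots> = c * gelem \<pi> * ((\<Sum>y\<in>arm s i. gelem (swp y z)) * young_sum (Suc s) * full_sum sgnp (col s))"
      unfolding Z_def column_sum_Suc(2)[of s] young_sum_def
      by (simp only: sum_distrib_left sum_distrib_right mult.assoc)
    also have "(\<Sum>y\<in>arm s i. gelem (swp y z)) * young_sum (Suc s) = - young_sum (Suc s)"
      unfolding arm_def by (rule garnir_young_sum[OF z])
    also have "c * gelem \<pi> * (- young_sum (Suc s) * full_sum sgnp (col s)) = - (c * gelem \<pi> * Z)"
      unfolding Z_def column_sum_Suc(2)[of s] young_sum_def by (simp add: mult.assoc)
    finally show ?thesis .
  qed
  have "of_nat (card (arm s i)) * (c * gelem \<pi> * Z) = (\<Sum>y\<in>arm s i. c * gelem \<pi> * Z)"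
    by simp
  also have "\<dots> = (\<Sum>y\<in>arm s i. \<Sum>l<?k. c * gelem (swp (?x l) y) * gelem \<pi> * Z)"
  proof (rule sum.cong)
    fix y assume "y \<in> arm s i"
    then have "c * (\<Sum>l<?k. gelem (swp (?x l) y)) = c"
      using young_sum_garnir[of y s] by (simp add: c_def sum_col arm_def)
    then show "c * gelem \<pi> * Z = (\<Sum>l<?k. c * gelem (swp (?x l) y) * gelem \<pi> * Z)"
      by (metis (no_types) sum_distrib_left sum_distrib_right)
  qed simp
  also have "\<dots> = (\<Sum>l<?k. \<Sum>y\<in>arm s i. c * gelem (swp (?x l) y) * gelem \<pi> * Z)"
    by (rule sum.swap)
  also have "\<dots> = (\<Sum>l\<in>{..<?k} - S. \<Sum>y\<in>arm s i. c * gelem (swp (?x l) y) * gelem \<pi> * Z)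
      + (\<Sum>l\<in>S. \<Sum>y\<in>arm s i. c * gelem (swp (?x l) y) * gelem \<pi> * Z)"
    by (rule sum.subset_diff) (use S in auto)
  also have "(\<Sum>l\<in>S. \<Sum>y\<in>arm s i. c * gelem (swp (?x l) y) * gelem \<pi> * Z) = - (of_nat (card S) * (c * gelem \<pi> * Z))"
    by (simp add: mem)
  also have "(\<Sum>l\<in>{..<?k} - S. \<Sum>y\<in>arm s i. c * gelem (swp (?x l) y) * gelem \<pi> * Z)
      = (\<Sum>l\<in>{..<?k} - S. c * row_step s i * gelem \<pi> * Z)"
    unfolding row_step_def sum_distrib_left sum_distrib_right
    by (intro sum.cong refl) (use notin in auto)
  also have "\<dots> = of_nat (?k - card S) * (c * row_step s i * gelem \<pi> * Z)"
    using S by (simp add: card_Diff_subset)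
  finally show ?thesis by (simp add: distrib_right algebra_simps)
qed

text \<open>\<open>S\<close> lies below row \<open>i\<close>, so \<open>\<pi>\<close> fixes
  \<open>cell i s\<close> and the whole arm of row \<open>i\<close>. The new transposition is
  therefore disjoint from what \<open>\<pi>\<close> moves, and it touches only row
  \<open>i\<close>.\<close>

lemma row_shift_insert:
  assumes \<pi>: "row_shift s (Suc i) S \<pi>" and i: "i < height s" and y: "y \<in> arm s i"
  shows "row_shift s i (insert i S) (swp (cell i s) y + \<pi>)"
proof -
  have S: "S \<subseteq> {Suc i..<height s}" using \<pi> by (auto simp: row_shift_def)
  note ne = cell_neq_arm
  have ne': "cell l s \<noteq> cell i s" if "l < height s" "l \<noteq> i" for l
    using that i cell_col(2) by metis
  have py: "app (- \<pi>) y = y" by (rule row_shift_fix(2)[OF \<pi> _ y]) simp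
  show ?thesis unfolding row_shift_def
  proof (intro conjI allI impI ballI)
    show "insert i S \<subseteq> {i..<height s}" using S i by auto
    fix l assume "l < height s" "l \<notin> insert i S"
    then show "app (swp (cell i s) y + \<pi>) (cell l s) = cell l s"
      using \<pi> ne[of l s y i] ne'[of l] y by (simp add: row_shift_def Transposition.transpose_def)
  next
    fix l assume l: "l \<in> insert i S"
    show "app (- (swp (cell i s) y + \<pi>)) (cell l s) \<in> arm s l"
    proof (cases "l = i")
      case True
      then show ?thesis using py y by (simp add: minus_add del: add_uminus_conv_diff)
    next
      case False
      then have "l \<in> S" using l by simp
      then show ?thesis using False \<pi> S ne[of l s y i] ne'[of l] y
        by (simp add: minus_add row_shift_def Transposition.transpose_def subset_iff del: add_uminus_conv_diff)
    qed
  next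
    fix l z assume l: "l < i" "z \<in> arm s l"
    then have "z \<noteq> y" using y by (auto simp: arm_def)
    then show "app (swp (cell i s) y + \<pi>) z = z"
      using l row_shift_fix(1)[OF \<pi> _ l(2)] ne[of i s z l] i by (simp add: Transposition.transpose_def)
  qed
qed

text \<open>Each factor of \<open>row_prefix\<close> contributes one hook length. Expand the last
  factor: the identity keeps \<open>S\<close> and \<open>\<pi>\<close>, each transposition puts
  \<open>i\<close> into \<open>S\<close>, and \<open>row_step_shift\<close> turns the sum of the
  latter terms back into a multiple of \<open>c * gelem \<pi> * Z\<close>. This is why
  \<open>S\<close> and \<open>\<pi>\<close> vary in the induction; the factorials replace the
  divisions by \<open>k - card S\<close> that \<open>row_step_shift\<close> asks for.\<close>

lemma row_prefix_shift:
  fixes s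
  defines "c \<equiv> young_sum s" and "Z \<equiv> row_sum (Suc s) * column_sum s" and "k \<equiv> height s"
  assumes "i \<le> k" "row_shift s i S \<pi>"
  shows "of_nat (fact (k - card S)) * (c * row_prefix s i * gelem \<pi> * Z)
    = of_nat (fact (k - i - card S) * (\<Prod>l<i. card (arm s l) + k - l)) * (c * gelem \<pi> * Z)"
  using assms(4,5)
proof (induction i arbitrary: S \<pi>)
  case 0
  then show ?case by simp
next
  case (Suc i)
  let ?A = "\<Prod>l<i. card (arm s l) + k - l" and ?x = "cell i s"
  define m where "m = k - Suc i - card S"
  have S: "S \<subseteq> {Suc i..<k}" using Suc.prems by (auto simp: row_shift_def k_def)
  then have fin: "finite S" "i \<notin> S" "card S \<le> k - Suc i"
    using finite_subset[OF S] card_mono[OF _ S] by auto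
  then have cs: "card (insert i S) = Suc (card S)" by simp
  \<comment> \<open>No subtraction is truncated, as \<open>S\<close> lies in
    \<open>{Suc i..<k}\<close>. The last equation produces the hook length: \<open>Suc m\<close>
    comes from the identity, \<open>card (arm s i) + card S\<close> from the transpositions.\<close>
  from fin have m: "k - i - card S = Suc m" "k - i - Suc (card S) = m" "k - card S = Suc (k - Suc (card S))"
    "Suc m + (card (arm s i) + card S) = card (arm s i) + k - i"
    using Suc.prems(1) by (auto simp: m_def)
  have i: "i < height s" using Suc.prems(1) by (simp add: k_def)
  have "row_shift s i S \<pi>"
    using Suc.prems(2) by (rule row_shift_SucD)
  then have 1: "of_nat (fact (k - card S)) * (c * row_prefix s i * gelem \<pi> * Z)
      = of_nat (fact m * ?A) * (of_nat (Suc m) * (c * gelem \<pi> * Z))"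
  proof -
    have "fact (Suc m) * ?A = fact m * ?A * Suc m" by (simp add: algebra_simps)
    then show ?thesis
      using Suc.IH[of S \<pi>] \<open>row_shift s i S \<pi>\<close> Suc.prems(1) unfolding m(1)
      by (simp only: of_nat_mult mult.assoc Suc_leD)
  qed
  have 2: "of_nat (fact (k - card S)) * (c * row_prefix s i * gelem (swp ?x y) * gelem \<pi> * Z)
      = of_nat (fact m * ?A) * (of_nat (k - card S) * (c * gelem (swp ?x y) * gelem \<pi> * Z))"
    if y: "y \<in> arm s i" for y
  proof -
    have "of_nat (fact (k - Suc (card S))) * (c * row_prefix s i * gelem (swp ?x y + \<pi>) * Z)
        = of_nat (fact m * ?A) * (c * gelem (swp ?x y + \<pi>) * Z)"
      by (rule Suc.IH[OF Suc_leD[OF Suc.prems(1)] row_shift_insert[OF Suc.prems(2) i y], unfolded cs m(2)])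
    then have "of_nat (k - card S) * (of_nat (fact (k - Suc (card S))) * (c * row_prefix s i * gelem (swp ?x y + \<pi>) * Z))
        = of_nat (k - card S) * (of_nat (fact m * ?A) * (c * gelem (swp ?x y + \<pi>) * Z))"
      by (rule arg_cong)
    moreover have "fact (k - card S) = (k - card S) * fact (k - Suc (card S))" unfolding m(3) by simp
    ultimately show ?thesis
      unfolding gelem_plus of_nat_left_commute[of "k - card S" "fact m * ?A"]
      by (simp only: of_nat_mult mult.assoc)
  qed
  have "of_nat (fact (k - card S)) * (c * row_prefix s (Suc i) * gelem \<pi> * Z)
      = of_nat (fact (k - card S)) * (c * row_prefix s i * gelem \<pi> * Z)
        + (\<Sum>y\<in>arm s i. of_nat (fact (k - card S)) * (c * row_prefix s i * gelem (swp ?x y) * gelem \<pi> * Z))"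
    by (simp only: row_prefix.simps row_step_def distrib_left distrib_right sum_distrib_left
        sum_distrib_right mult.assoc mult_1_left mult_1_right)
  also have "\<dots> = of_nat (fact m * ?A) * (of_nat (Suc m) * (c * gelem \<pi> * Z))
        + (\<Sum>y\<in>arm s i. of_nat (fact m * ?A) * (of_nat (k - card S) * (c * gelem (swp ?x y) * gelem \<pi> * Z)))"
    unfolding 1 by (intro arg_cong2[of _ _ _ _ "(+)"] sum.cong refl 2)
  also have "(\<Sum>y\<in>arm s i. of_nat (fact m * ?A) * (of_nat (k - card S) * (c * gelem (swp ?x y) * gelem \<pi> * Z)))
      = of_nat (fact m * ?A) * (of_nat (k - card S) * (c * row_step s i * gelem \<pi> * Z))"
    unfolding row_step_def sum_distrib_left sum_distrib_right ..
  also have "of_nat (k - card S) * (c * row_step s i * gelem \<pi> * Z)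
      = of_nat (card (arm s i) + card S) * (c * gelem \<pi> * Z)"
    using row_step_shift[OF Suc.prems(2) i] by (simp add: c_def Z_def k_def)
  also have "of_nat (fact m * ?A) * (of_nat (Suc m) * (c * gelem \<pi> * Z))
        + of_nat (fact m * ?A) * (of_nat (card (arm s i) + card S) * (c * gelem \<pi> * Z))
      = of_nat (fact m * ?A) * (of_nat (Suc m + (card (arm s i) + card S)) * (c * gelem \<pi> * Z))"
    by (simp only: of_nat_add distrib_left distrib_right)
  also have "\<dots> = of_nat (fact (k - Suc i - card S) * (\<Prod>l<Suc i. card (arm s l) + k - l)) * (c * gelem \<pi> * Z)"
    unfolding m(4) by (simp only: m_def prod.lessThan_Suc of_nat_mult mult.assoc)
  finally show ?case .
qed

text \<open>With \<open>c'\<close> the symmetrizer of the smaller shape, \<open>c = P c' B\<close>,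
  and \<open>B\<close> commutes with both factors of \<open>c'\<close>. Hence
  \<open>c c' = m c\<close>, and \<open>c Z = c B c'\<close> is \<open>k!\<close> times
  \<open>m c\<close>. On the other hand \<open>c c = c P Z\<close>, where
  \<open>row_prefix_shift\<close> removes \<open>P\<close> at the price of the hook lengths of
  column \<open>s\<close> and a factor \<open>k!\<close>, which cancels.\<close>

lemma young_sum_square_Suc:
  assumes "young_sum (Suc s) * young_sum (Suc s) = of_nat m * young_sum (Suc s)"
  shows "young_sum s * young_sum s
    = of_nat ((\<Prod>l<height s. card (arm s l) + height s - l) * m) * young_sum s"
proof -
  let ?c = "young_sum s" and ?k = "height s" and ?Z = "row_sum (Suc s) * column_sum s"
  let ?A = "\<Prod>l<?k. card (arm s l) + ?k - l" and ?B = "full_sum sgnp (col s)" and ?P = "row_prefix s (height s)"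
  let ?a = "row_sum (Suc s)" and ?b = "column_sum (Suc s)" and ?c' = "young_sum (Suc s)"
  have aB: "?a * ?B = ?B * ?a"
    unfolding row_sum_def using col_cells_disjoint by (intro stab_sum_commute) auto
  have bB: "?b * ?B = ?B * ?b" using column_sum_Suc[of s] by simp
  have c: "?c = ?P * ?c' * ?B"
    unfolding young_sum_def row_sum_Suc[of s] column_sum_Suc(2)[of s] by (simp only: mult.assoc)
  have cB: "?c * ?B = of_nat (fact ?k) * ?c"
  proof -
    have "stab (col s) (\<lambda>_. ()) \<subseteq> stab (cells s) cl"
      by (rule stab_mono) (auto simp: col_def cells_def)
    then have "?c * ?B = of_nat (card (stab (col s) (\<lambda>_. ()))) * ?c"
      by (intro mult_stab_sum_absorb[OF perm_character_sgnp] young_sum_absorb_right) auto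
    then show ?thesis by (simp add: card_stab_full height_def)
  qed
  have "?c * ?c' = ?P * ?c' * (?B * ?a) * ?b"
    unfolding c young_sum_def[of "Suc s"] by (simp only: mult.assoc)
  also have "\<dots> = ?P * (?c' * ?c') * ?B"
    unfolding young_sum_def[of "Suc s"] aB[symmetric] by (simp only: mult.assoc bB)
  also have "\<dots> = of_nat m * ?c"
    unfolding assms c using mult_of_int_left_commute[of ?P "int m" ?c'] by (simp add: mult.assoc)
  finally have cc': "?c * ?c' = of_nat m * ?c" .
  have "?c * ?Z = (?c * ?B) * ?c'"
    unfolding column_sum_Suc(1)[of s] young_sum_def[of "Suc s"]
    by (simp only: mult.assoc[symmetric]) (simp only: mult.assoc aB)
  also have "\<dots> = of_nat (fact ?k) * (of_nat m * ?c)"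
    unfolding cB by (simp only: mult.assoc cc')
  finally have cZ: "?c * ?Z = of_nat (fact ?k) * (of_nat m * ?c)" .
  \<comment> \<open>All rows of the column are processed and no transposition is pending, so the
    factorial left on the right is that of 0.\<close>
  have "row_shift s ?k {} 0" by (auto simp: row_shift_def)
  from row_prefix_shift[OF _ this]
  have "of_nat (fact ?k) * (?c * ?P * ?Z) = of_nat ?A * (?c * ?Z)"
    by simp
  also have "\<dots> = of_nat (fact ?k) * (of_nat (?A * m) * ?c)"
    unfolding cZ by (simp only: mult.assoc[symmetric] of_nat_mult[symmetric]) (simp only: mult.commute mult.left_commute)
  finally have "?c * ?P * ?Z = of_nat (?A * m) * ?c"
    by (rule of_nat_mult_cancel) simp
  moreover have "?c * ?c = ?c * ?P * ?Z"
    unfolding young_sum_def[of s] row_sum_Suc[of s] by (simp only: mult.assoc)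
  ultimately show ?thesis by simp
qed

text \<open>The corner cell is counted with the leg, which has \<open>height s - l\<close> cells;
  the arm is strictly to the right.\<close>

lemma hook_length_eq:
  assumes "l < height s"
  shows "hook_length lam (l, s) = card (arm s l) + height s - l"
proof -
  let ?R = "{l} \<times> {j. (l, j) \<in> diagram lam \<and> s < j}" and ?C = "{l..<height s} \<times> {s}"
  have "hook lam (l, s) = ?R \<union> ?C"
    using assms by (auto simp: hook_def diagram_iff)
  moreover have bij: "bij_betw (\<lambda>y. (l, cl y)) (arm s l) ?R"
  proof (rule bij_betwI[where g = "\<lambda>(l, j). cell l j"])
    show "(\<lambda>y. (l, cl y)) \<in> arm s l \<rightarrow> ?R" using label_mem by (auto simp: arm_def cells_def)
    show "(\<lambda>(l, j). cell l j) \<in> ?R \<rightarrow> arm s l" using cell by (auto simp: arm_def cells_def)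
  qed (use cell cell_label in \<open>auto simp: arm_def cells_def\<close>)
  have "finite ?R" "card ?R = card (arm s l)"
    using bij_betw_finite[OF bij] bij_betw_same_card[OF bij] by simp_all
  moreover have "?R \<inter> ?C = {}" by auto
  ultimately show ?thesis using assms by (simp add: hook_length_def card_Un_disjoint card_cartesian_product)
qed

text \<open>Columns are put back from right to left. With all columns dropped the symmetrizer and
  the product are 1, and each column restored contributes the hook lengths of its own cells.\<close>

theorem young_sum_square:
  "young_sum 0 * young_sum 0 = of_nat (\<Prod>c\<in>diagram lam. hook_length lam c) * young_sum 0"
proof -
  obtain N where N: "\<And>x. x \<in> X \<Longrightarrow> cl x < N"
    using finite_X by (metis finite_imageI finite_nat_set_iff_bounded imageI)
  have *: "young_sum s * young_sum s
      = of_nat (\<Prod>c\<in>{c \<in> diagram lam. s \<le> snd c}. hook_length lam c) * young_sum s" if "s \<le> N" for s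
    using that
  proof (induction rule: inc_induct)
    case base
    have "cells N = {}" using N by (force simp: cells_def)
    then have "young_sum N = 1"
      by (simp add: young_sum_def row_sum_def column_sum_def stab_sum_empty perm_character_one perm_character_sgnp)
    moreover have "{c \<in> diagram lam. N \<le> snd c} = {}" using N cell by force
    ultimately show ?case by (simp only: prod.empty of_nat_1 mult_1)
  next
    case (step s)
    let ?D = "\<lambda>s. {c \<in> diagram lam. s \<le> snd c}" and ?C = "(\<lambda>l. (l, s)) ` {..<height s}"
    have "?D s = ?C \<union> ?D (Suc s)" by (auto simp: diagram_iff[symmetric] le_less Suc_le_eq)
    moreover have "?C \<inter> ?D (Suc s) = {}" by auto
    moreover have "finite (?D (Suc s))" using finite_diagram by simp
    ultimately have "(\<Prod>c\<in>?D s. hook_length lam c)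
        = (\<Prod>c\<in>?C. hook_length lam c) * (\<Prod>c\<in>?D (Suc s). hook_length lam c)"
      by (simp add: prod.union_disjoint)
    also have "(\<Prod>c\<in>?C. hook_length lam c) = (\<Prod>l<height s. hook_length lam (l, s))"
      by (subst prod.reindex) (auto simp: inj_on_def)
    also have "\<dots> = (\<Prod>l<height s. card (arm s l) + height s - l)"
      by (intro prod.cong) (auto simp: hook_length_eq)
    finally show ?case using young_sum_square_Suc[OF step.IH] by simp
  qed
  show ?thesis using *[of 0] by simp
qed

end

subsection \<open>Products \<open>c \<sigma> c\<close>\<close>

lemma lookup_stab_sum:
  assumes "finite X"
  shows "Poly_Mapping.lookup (stab_sum \<epsilon> X f) p = (if p \<in> stab X f then \<epsilon> p else 0)"
proof -
  have "Poly_Mapping.lookup (stab_sum \<epsilon> X f) p = (\<Sum>q\<in>stab X f. if q = p then \<epsilon> q else 0)"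
    unfolding stab_sum_def lookup_sum
    by (intro sum.cong) (auto simp: lookup_of_int_mult lookup_single when_def)
  then show ?thesis using finite_stab[OF assms, of f] by simp
qed

lemma lookup_stab_sum_mult:
  "Poly_Mapping.lookup (stab_sum \<epsilon> X f * x) p = (\<Sum>q\<in>stab X f. \<epsilon> q * Poly_Mapping.lookup x (- q + p))"
  unfolding stab_sum_def sum_distrib_right lookup_sum
  by (simp add: mult.assoc lookup_of_int_mult lookup_gelem_mult)

text \<open>The coefficient at the identity is a trace: for a single permutation \<open>p\<close>
  both products have there the coefficient of \<open>x\<close> at \<open>- p\<close>.\<close>

lemma lookup_mult_stab_sum_0:
  "Poly_Mapping.lookup (x * stab_sum \<epsilon> X f) 0 = Poly_Mapping.lookup (stab_sum \<epsilon> X f * x) 0"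
  unfolding stab_sum_def sum_distrib_right sum_distrib_left lookup_sum
  by (simp add: mult.assoc mult_of_int_left_commute lookup_of_int_mult lookup_gelem_mult lookup_mult_gelem)

context labelled_diagram
begin

abbreviation sym where "sym \<equiv> stab X (\<lambda>_. ())"
abbreviation row_perms where "row_perms \<equiv> stab X rw"
abbreviation column_perms where "column_perms \<equiv> stab X cl"

lemma stab_subset_sym: "stab X f \<subseteq> sym"
  by (rule stab_mono) auto

lemma cells_0: "cells 0 = X"
  by (simp add: cells_def)

lemma row_column_perms_disjoint:
  assumes "p \<in> row_perms" "p \<in> column_perms"
  shows "p = 0"
proof (rule fperm_eqI)
  fix x
  show "app p x = app 0 x"
  proof (cases "x \<in> X")
    case True
    then show ?thesis
      using label_inj[of "app p x" x] app_stab_mem[OF assms(1)] stab_label[OF assms(1)] stab_label[OF assms(2)]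
      by simp
  qed (use stab_fix[OF assms(1)] in simp)
qed

lemma lookup_young_sum:
  "Poly_Mapping.lookup (young_sum 0) p
    = (\<Sum>q\<in>row_perms. if - q + p \<in> column_perms then sgnp (- q + p) else 0)"
  unfolding young_sum_def row_sum_def column_sum_def cells_0 lookup_stab_sum_mult
  by (simp add: lookup_stab_sum[OF finite_X])

text \<open>A row permutation that is also a column permutation is the identity. The coefficient 1
  lets scalars multiplying the symmetrizer be read off at the identity.\<close>

lemma lookup_young_sum_0: "Poly_Mapping.lookup (young_sum 0) 0 = 1"
proof -
  have "(if - q + 0 \<in> column_perms then sgnp (- q + 0) else 0) = (if q = 0 then 1 else 0)"
    if "q \<in> row_perms" for q
    using row_column_perms_disjoint[of "- q"] stab_uminus[OF that] by auto
  then have "Poly_Mapping.lookup (young_sum 0) 0 = (\<Sum>q\<in>row_perms. if q = 0 then 1 else 0)"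
    unfolding lookup_young_sum by (intro sum.cong) auto
  then show ?thesis using finite_stab[OF finite_X, of rw] by simp
qed

lemma lookup_young_sum_eq_0: "p \<notin> sym \<Longrightarrow> Poly_Mapping.lookup (young_sum 0) p = 0"
proof -
  assume p: "p \<notin> sym"
  have "- q + p \<notin> column_perms" if q: "q \<in> row_perms" for q
  proof
    assume "- q + p \<in> column_perms"
    then have "q + (- q + p) \<in> sym"
      using q stab_subset_sym[of rw] stab_subset_sym[of cl] by (intro stab_plus[of q]) auto
    then show False using p by (simp add: add.assoc[symmetric])
  qed
  then show ?thesis unfolding lookup_young_sum by simp
qed

text \<open>A counting argument: the columns of \<open>p\<close> together contain as many entries of the first \<open>r\<close> rows
  as they possibly can, so each of them does.\<close>

lemma row_image_less_height:
  assumes p: "p \<in> sym"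
    and inj: "\<And>x y. x \<in> X \<Longrightarrow> y \<in> X \<Longrightarrow> cl x = cl y \<Longrightarrow> rw (app p x) = rw (app p y) \<Longrightarrow> x = y"
    and y: "y \<in> X"
  shows "rw (app p y) < height (cl y)"
proof -
  obtain N where N: "\<And>x. x \<in> X \<Longrightarrow> cl x < N"
    using finite_X by (metis finite_imageI finite_nat_set_iff_bounded imageI)
  define r where "r = height (cl y)"
  let ?f = "\<lambda>p j. {x \<in> col j. rw (app p x) < r}"
  have count: "card {x \<in> X. rw (app p x) < r} = (\<Sum>j<N. card (?f p j))" for p
  proof -
    have "{x \<in> X. rw (app p x) < r} = (\<Union>j\<in>{..<N}. ?f p j)" using N by (auto simp: col_def)
    moreover have "card (\<Union>j\<in>{..<N}. ?f p j) = (\<Sum>j<N. card (?f p j))"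
      by (rule card_UN_disjoint) (auto simp: col_def finite_X)
    ultimately show ?thesis by simp
  qed
  have f0: "card (?f 0 j) = min (height j) r" for j
  proof -
    have "bij_betw rw (?f 0 j) {..<min (height j) r}"
      by (rule bij_betwI[where g = "\<lambda>i. cell i j"])
        (use cell_col[of _ j] cell_label label_mem diagram_iff in \<open>auto simp: col_def\<close>)
    then show ?thesis using bij_betw_same_card by fastforce
  qed
  have fp: "card (?f p j) \<le> min (height j) r" for j
  proof -
    have "card (?f p j) \<le> height j" unfolding height_def by (intro card_mono) auto
    moreover have "inj_on (\<lambda>x. rw (app p x)) (?f p j)" using inj by (auto simp: inj_on_def col_def)
    then have "card (?f p j) \<le> card {..<r}" by (rule card_inj_on_le) auto
    ultimately show ?thesis by simp
  qed
  have "bij_betw (app p) {x \<in> X. rw (app p x) < r} {x \<in> X. rw (app 0 x) < r}"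
    by (rule bij_betwI[where g = "app (- p)"])
      (use app_stab_mem[OF p] app_stab_mem[OF stab_uminus[OF p]] in auto)
  then have "(\<Sum>j<N. card (?f p j)) = (\<Sum>j<N. min (height j) r)"
    using bij_betw_same_card count[of p] count[of 0] f0 by fastforce
  then have "card (?f p (cl y)) = min (height (cl y)) r"
    by (rule sum_mono_inv[OF _ fp]) (use N[OF y] in auto)
  \<comment> \<open>As \<open>r\<close> is the height of the column of \<open>y\<close>, the minimum
    is the size of that whole column, so \<open>p\<close> sends all of it into the first
    \<open>r\<close> rows.\<close>
  then have "card (?f p (cl y)) = card (col (cl y))" by (simp add: r_def height_def)
  then have "?f p (cl y) = col (cl y)" by (intro card_subset_eq) auto
  moreover have "y \<in> col (cl y)" using y by (simp add: col_def)
  ultimately show ?thesis by (auto simp: r_def)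
qed

text \<open>The column factor \<open>g\<close> keeps each entry in its column and puts it into the
  row where \<open>p\<close> sends it; \<open>row_image_less_height\<close> says that this cell
  exists. What remains of \<open>p\<close> after undoing \<open>g\<close> preserves rows.\<close>

lemma row_column_factorization:
  assumes p: "p \<in> sym"
    and inj: "\<And>x y. x \<in> X \<Longrightarrow> y \<in> X \<Longrightarrow> cl x = cl y \<Longrightarrow> rw (app p x) = rw (app p y) \<Longrightarrow> x = y"
  obtains r q where "r \<in> row_perms" "q \<in> column_perms" "p = r + q"
proof -
  define g where "g y = (if y \<in> X then cell (rw (app p y)) (cl y) else y)" for y
  have g: "g y \<in> X" "rw (g y) = rw (app p y)" "cl (g y) = cl y" if "y \<in> X" for y
  proof -
    have d: "(rw (app p y), cl y) \<in> diagram lam"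
      unfolding diagram_iff by (rule row_image_less_height[OF p inj that])
    show "g y \<in> X" "rw (g y) = rw (app p y)" "cl (g y) = cl y"
      using cell[OF d] that by (simp_all add: g_def)
  qed
  have "inj_on g X" 
  proof (rule inj_onI)
    fix x y assume "x \<in> X" "y \<in> X" "g x = g y"
    then show "x = y" using g[of x] g[of y] inj[of x y] by simp
  qed
  moreover have "g ` X \<subseteq> X" using g by auto
  ultimately have "bij_betw g X X" using finite_X by (simp add: bij_betw_def endo_inj_surj)
  then have "g permutes X" by (rule bij_imp_permutes) (simp add: g_def)
  then have app: "app (Fperm g) = g"
    using finite_X by (intro app_Fperm permutes_imp_permutation[of X])
  have q: "Fperm g \<in> column_perms" using g by (auto simp: stab_def app) (simp add: g_def)
  have "p - Fperm g \<in> row_perms"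
  proof -
    have "p + - Fperm g \<in> sym" 
      using p stab_uminus[OF q] stab_subset_sym[of cl] by (intro stab_plus) auto
    moreover have "rw (app (p + - Fperm g) x) = rw x" if "x \<in> X" for x
    proof -
      define y where "y = app (- Fperm g) x"
      have "y \<in> X" using that app_stab_mem[OF stab_uminus[OF q]] by (simp add: y_def)
      moreover have "g y = app (Fperm g) y" by (simp add: app)
      then have "g y = x" by (simp add: y_def)
      ultimately show ?thesis using g(2)[of y] by (simp add: y_def del: add_uminus_conv_diff)
    qed
    ultimately show ?thesis by (auto simp: stab_def)
  qed
  then show ?thesis using q that[of "p - Fperm g" "Fperm g"] by simp
qed

text \<open>Either \<open>p\<close> sends two entries of one column into one row, and their
  transposition shows that the product is its own negative, or \<open>p\<close> is a row permutation
  times a column permutation, both absorbed up to sign.\<close>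

lemma row_gelem_column:
  assumes p: "p \<in> sym"
  shows "\<exists>m. row_sum 0 * gelem p * column_sum 0 = of_int m * young_sum 0"
proof (cases "\<exists>x y. x \<in> X \<and> y \<in> X \<and> cl x = cl y \<and> rw (app p x) = rw (app p y) \<and> x \<noteq> y")
  case True
  then obtain x y where xy: "x \<in> X" "y \<in> X" "cl x = cl y" "rw (app p x) = rw (app p y)" "x \<noteq> y" by blast
  have px: "app p x \<in> X" "app p y \<in> X" using xy app_stab_mem[OF p] by auto
  have 1: "gelem p * gelem (swp x y) = gelem (swp (app p x) (app p y)) * gelem p"
    by (simp add: add_swp flip: gelem_plus)
  have 2: "row_sum 0 * gelem (swp (app p x) (app p y)) = row_sum 0"
    by (rule row_sum_swp(2)) (use px xy in \<open>auto simp: cells_0\<close>)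
  have 3: "gelem (swp x y) * column_sum 0 = - column_sum 0"
    by (rule column_sum_swp(1)) (use xy in \<open>auto simp: cells_0\<close>)
  have "- (row_sum 0 * gelem p * column_sum 0) = row_sum 0 * (gelem p * gelem (swp x y)) * column_sum 0"
    by (simp only: mult.assoc 3 mult_minus_right)
  also have "\<dots> = row_sum 0 * gelem p * column_sum 0"
    unfolding 1 by (simp only: mult.assoc[symmetric] 2)
  finally have "row_sum 0 * gelem p * column_sum 0 = - (row_sum 0 * gelem p * column_sum 0)" ..
  then have "row_sum 0 * gelem p * column_sum 0 = of_int 0 * young_sum 0"
    using eq_uminus_imp_zero by simp
  then show ?thesis ..
next
  case False
  then obtain r q where rq: "r \<in> row_perms" "q \<in> column_perms" "p = r + q"
    using row_column_factorization[OF p] by blast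
  have "row_sum 0 * gelem p * column_sum 0 = (row_sum 0 * gelem r) * (gelem q * column_sum 0)"
    unfolding rq(3) gelem_plus by (simp only: mult.assoc)
  also have "row_sum 0 * gelem r = row_sum 0"
    using stab_sum_mult_gelem[OF perm_character_one rq(1)] by (simp add: row_sum_def cells_0)
  also have "gelem q * column_sum 0 = of_int (sgnp q) * column_sum 0"
    using gelem_mult_stab_sum[OF perm_character_sgnp rq(2)] by (simp add: column_sum_def cells_0)
  also have "row_sum 0 * (of_int (sgnp q) * column_sum 0) = of_int (sgnp q) * young_sum 0"
    by (simp add: mult_of_int_left_commute young_sum_def)
  finally show ?thesis ..
qed

text \<open>Write \<open>c p c\<close> as \<open>a (b p a) b\<close> with \<open>a\<close> the row
  sum and \<open>b\<close> the column sum. After expanding the bracket every term is a multiple of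
  \<open>c\<close> by \<open>row_gelem_column\<close>, so only the scalar is left to find.\<close>

lemma young_sum_sandwich:
  assumes p: "p \<in> sym"
  shows "young_sum 0 * gelem p * young_sum 0
    = of_int (int (\<Prod>c\<in>diagram lam. hook_length lam c) * Poly_Mapping.lookup (young_sum 0) (- p)) * young_sum 0"
proof -
  let ?c = "young_sum 0" and ?H = "\<Prod>c\<in>diagram lam. hook_length lam c"
  have "\<forall>p\<in>sym. \<exists>m. row_sum 0 * gelem p * column_sum 0 = of_int m * ?c"
    using row_gelem_column by blast
  then obtain m where m: "\<And>p. p \<in> sym \<Longrightarrow> row_sum 0 * gelem p * column_sum 0 = of_int (m p) * ?c"
    by metis
  let ?m = "\<Sum>q\<in>column_perms. \<Sum>r\<in>row_perms. sgnp q * m (q + p + r)"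
  have "?c * gelem p * ?c = row_sum 0 * (column_sum 0 * gelem p * row_sum 0) * column_sum 0"
    by (simp only: young_sum_def mult.assoc)
  also have "column_sum 0 * gelem p * row_sum 0
      = (\<Sum>q\<in>column_perms. \<Sum>r\<in>row_perms. of_int (sgnp q) * gelem (q + p + r))"
  proof -
    have "gelem p * row_sum 0 = (\<Sum>r\<in>row_perms. gelem (p + r))"
      by (simp add: row_sum_def stab_sum_def cells_0 sum_distrib_left mult_single)
    then have "column_sum 0 * (gelem p * row_sum 0)
        = (\<Sum>q\<in>column_perms. \<Sum>r\<in>row_perms. (of_int (sgnp q) * gelem q) * gelem (p + r))"
      by (simp only: column_sum_def stab_sum_def cells_0 sum_product)
    then show ?thesis by (simp add: mult.assoc mult_single add.assoc)
  qed
  also have "row_sum 0 * (\<Sum>q\<in>column_perms. \<Sum>r\<in>row_perms. of_int (sgnp q) * gelem (q + p + r)) * column_sum 0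
      = (\<Sum>q\<in>column_perms. \<Sum>r\<in>row_perms. of_int (sgnp q) * (row_sum 0 * gelem (q + p + r) * column_sum 0))"
    unfolding sum_distrib_left sum_distrib_right mult_of_int_left_commute by (simp only: mult.assoc)
  also have "\<dots> = (\<Sum>q\<in>column_perms. \<Sum>r\<in>row_perms. of_int (sgnp q * m (q + p + r)) * ?c)"
  proof (intro sum.cong refl)
    fix q r assume "q \<in> column_perms" "r \<in> row_perms"
    then have "q + p + r \<in> sym" 
      using p stab_subset_sym[of rw] stab_subset_sym[of cl] by (intro stab_plus) auto
    then show "of_int (sgnp q) * (row_sum 0 * gelem (q + p + r) * column_sum 0)
        = of_int (sgnp q * m (q + p + r)) * ?c"
      using m by (simp add: mult.assoc)
  qed
  also have "\<dots> = of_int ?m * ?c"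
    by (simp only: of_int_sum sum_distrib_right)
  finally have cpc: "?c * gelem p * ?c = of_int ?m * ?c" .
  \<comment> \<open>The scalar is the coefficient at the identity. By the trace property the factors
    \<open>b\<close> and then \<open>a\<close> of the right-hand \<open>c\<close> may be moved to
    the front, which gives \<open>c c p\<close> and lets the hook length formula apply.\<close>
  have "?m = Poly_Mapping.lookup (?c * gelem p * ?c) 0"
    unfolding cpc lookup_of_int_mult lookup_young_sum_0 by simp
  also have "?c * gelem p * ?c = ?c * gelem p * row_sum 0 * column_sum 0"
    by (simp only: young_sum_def mult.assoc)
  also have "Poly_Mapping.lookup \<dots> 0 = Poly_Mapping.lookup (column_sum 0 * ?c * gelem p * row_sum 0) 0"
    using lookup_mult_stab_sum_0[of "?c * gelem p * row_sum 0" sgnp "cells 0" cl]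
    by (simp only: column_sum_def mult.assoc)
  also have "\<dots> = Poly_Mapping.lookup (row_sum 0 * (column_sum 0 * ?c * gelem p)) 0"
    using lookup_mult_stab_sum_0[of "column_sum 0 * ?c * gelem p" "\<lambda>_. 1" "cells 0" rw]
    by (simp only: row_sum_def)
  also have "row_sum 0 * (column_sum 0 * ?c * gelem p) = ?c * ?c * gelem p"
    by (simp only: young_sum_def[of 0] mult.assoc)
  also have "Poly_Mapping.lookup \<dots> 0 = int ?H * Poly_Mapping.lookup (?c * gelem p) 0"
    unfolding young_sum_square mult.assoc lookup_of_nat_mult by simp
  also have "Poly_Mapping.lookup (?c * gelem p) 0 = Poly_Mapping.lookup ?c (- p)"
    by (simp add: lookup_mult_gelem)
  finally show ?thesis using cpc by simp
qed

end

subsection \<open>Density of \<open>GL(n,R)\<close>\<close>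

lemma sum_fun_apply: "(\<Sum>x\<in>A. f x) w = (\<Sum>x\<in>A. f x w)"
  by (induction A rule: infinite_finite_induct) auto

section \<open>Inclusion-exclusion and polarization of tensor powers of matrices\<close>

lemma sum_alternating_supersets:
  assumes "finite A" "T \<subseteq> A"
  shows "(\<Sum>S\<in>Pow A. if T \<subseteq> S then (- 1) ^ card (A - S) else 0) = (if T = A then 1 else 0 :: 'b::comm_ring_1)"
proof -
  have "(\<Sum>S\<in>Pow A. if T \<subseteq> S then (- 1) ^ card (A - S) else 0)
      = (\<Sum>S | S \<in> Pow A \<and> T \<subseteq> S. (- 1) ^ card (A - S) :: 'b)"
    using assms by (intro sum.inter_filter[symmetric]) auto
  also have "\<dots> = (\<Sum>S\<in>Pow (A - T). (- 1) ^ card (A - T - S))"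
    by (rule sum.reindex_bij_witness[of _ "\<lambda>S. T \<union> S" "\<lambda>S. S - T"])
      (use assms in \<open>auto intro!: arg_cong[of _ _ card] arg_cong[of _ _ "(^) _"]\<close>)
  \<comment> \<open>The sum over subsets is the expansion of a product of factors
    \<open>1 - 1\<close>, empty exactly when \<open>T = A\<close>.\<close>
  also have "\<dots> = (\<Prod>x\<in>A - T. 1 + - 1)"
    by (subst prod_add) (use assms in auto)
  also have "\<dots> = (if T = A then 1 else 0)"
    using assms by (auto simp: power_0_left)
  finally show ?thesis .
qed

text \<open>Ryser's formula for the permanent. Expand the product of row sums over all maps from
  \<open>A\<close> to \<open>A\<close>; inclusion-exclusion keeps the surjective ones, and on a
  finite set these are the permutations.\<close>

lemma permanent_ryser:
  fixes a :: "'a \<Rightarrow> 'a \<Rightarrow> 'b::comm_ring_1"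
  assumes A: "finite A"
  shows "(\<Sum>S\<in>Pow A. (- 1) ^ card (A - S) * (\<Prod>i\<in>A. \<Sum>k\<in>S. a i k))
    = (\<Sum>\<tau> | \<tau> permutes A. \<Prod>i\<in>A. a i (\<tau> i))"
proof -
  let ?F = "PiE A (\<lambda>_. A)" and ?p = "\<lambda>g. \<Prod>i\<in>A. a i (g i)"
  have F: "finite ?F" using A by (intro finite_PiE) auto
  have "(\<Prod>i\<in>A. \<Sum>k\<in>S. a i k) = (\<Sum>g\<in>?F. if g ` A \<subseteq> S then ?p g else 0)" if "S \<in> Pow A" for S
  proof -
    have "finite S" using that A finite_subset by auto
    then have "(\<Prod>i\<in>A. \<Sum>k\<in>S. a i k) = (\<Sum>g\<in>PiE A (\<lambda>_. S). ?p g)"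
      using A by (intro prod_sum_PiE) auto
    also have "PiE A (\<lambda>_. S) = {g \<in> ?F. g ` A \<subseteq> S}" using that by (auto simp: PiE_iff extensional_def)
    finally show ?thesis using F by (simp add: sum.inter_filter)
  qed
  then have "(\<Sum>S\<in>Pow A. (- 1) ^ card (A - S) * (\<Prod>i\<in>A. \<Sum>k\<in>S. a i k))
      = (\<Sum>S\<in>Pow A. \<Sum>g\<in>?F. ?p g * (if g ` A \<subseteq> S then (- 1) ^ card (A - S) else 0))"
    by (intro sum.cong refl) (auto simp: sum_distrib_left intro!: sum.cong)
  also have "\<dots> = (\<Sum>g\<in>?F. ?p g * (\<Sum>S\<in>Pow A. if g ` A \<subseteq> S then (- 1) ^ card (A - S) else 0))"
    by (subst sum.swap) (simp only: sum_distrib_left)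
  also have "\<dots> = (\<Sum>g\<in>?F. if g ` A = A then ?p g else 0)"
  proof (rule sum.cong)
    fix g assume "g \<in> ?F"
    then have "g ` A \<subseteq> A" by auto
    then show "?p g * (\<Sum>S\<in>Pow A. if g ` A \<subseteq> S then (- 1) ^ card (A - S) else 0) = (if g ` A = A then ?p g else 0)"
      using sum_alternating_supersets[OF A, of "g ` A", where 'b = 'b] by simp
  qed simp
  also have "\<dots> = (\<Sum>g | g \<in> ?F \<and> g ` A = A. ?p g)"
    using F by (intro sum.inter_filter[symmetric])
  also have "\<dots> = (\<Sum>\<tau> | \<tau> permutes A. ?p \<tau>)"
  proof (rule sum.reindex_bij_witness[of _ "\<lambda>\<tau>. restrict \<tau> A" "\<lambda>g x. if x \<in> A then g x else x"])
    fix g assume g: "g \<in> {g. g \<in> ?F \<and> g ` A = A}"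
    then have "inj_on g A" using A by (auto intro: eq_card_imp_inj_on)
    then have "bij_betw (\<lambda>x. if x \<in> A then g x else x) A A"
      using g by (auto simp: bij_betw_def inj_on_def)
    then show "(\<lambda>x. if x \<in> A then g x else x) \<in> {\<tau>. \<tau> permutes A}"
      by (auto intro: bij_imp_permutes)
    show "restrict (\<lambda>x. if x \<in> A then g x else x) A = g"
      using g by (auto simp: fun_eq_iff restrict_def PiE_def extensional_def)
    show "?p (\<lambda>x. if x \<in> A then g x else x) = ?p g" by simp
  next
    fix \<tau> assume "\<tau> \<in> {\<tau>. \<tau> permutes A}"
    then have \<tau>: "\<tau> permutes A" by simp
    show "(\<lambda>x. if x \<in> A then restrict \<tau> A x else x) = \<tau>"
      using permutes_not_in[OF \<tau>] by auto
    show "restrict \<tau> A \<in> {g. g \<in> ?F \<and> g ` A = A}"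
      using permutes_image[OF \<tau>] by auto
  qed
  finally show ?thesis .
qed

text \<open>A sum of matrix units, one for each place in \<open>S\<close>, at row
  \<open>I ! k\<close> and column \<open>J ! k\<close>.\<close>

definition unit_sum :: "'n list \<Rightarrow> 'n list \<Rightarrow> nat set \<Rightarrow> 'k::field^'n::finite^'n" where
  "unit_sum I J S = (\<chi> a b. \<Sum>k\<in>S. if a = I ! k \<and> b = J ! k then 1 else 0)"

text \<open>Polarization of the \<open>d\<close>-th tensor power of a matrix: the alternating sum
  isolates the term that uses each of the \<open>d\<close> matrix units once. Its entries are
  permanents, so Ryser's formula evaluates them without any division by a factorial.\<close>

lemma polarized_tensor_act:
  fixes w :: "'n::finite list \<Rightarrow> 'k::field"
  assumes I: "length I = d" and J: "length J = d" and L: "length L = d"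
  shows "(\<Sum>S\<in>Pow {..<d}. (- 1) ^ card ({..<d} - S) * tensor_act (unit_sum I J S) w L)
    = (\<Sum>\<tau> | \<tau> permutes {..<d}. if L = permute_list \<tau> J then w (permute_list \<tau> I) else 0)"
proof -
  let ?e = "\<lambda>u i k. if u ! i = I ! k \<and> L ! i = J ! k then 1 else 0 :: 'k"
  have delta: "(\<Prod>i<d. ?e u i (\<tau> i)) = (if u = permute_list \<tau> I \<and> L = permute_list \<tau> J then 1 else 0)"
    if "length u = d" "\<tau> permutes {..<d}" for u \<tau>
  proof (cases "u = permute_list \<tau> I \<and> L = permute_list \<tau> J")
    case True
    then show ?thesis using that I J by (auto intro!: prod.neutral simp: permute_list_nth)
  next
    case False
    have "\<exists>i<d. \<not> (u ! i = I ! \<tau> i \<and> L ! i = J ! \<tau> i)"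
    proof (rule ccontr)
      assume "\<not> ?thesis"
      then have "u = permute_list \<tau> I" "L = permute_list \<tau> J"
        using that I J L by (auto intro!: nth_equalityI simp: permute_list_nth)
      with False show False by simp
    qed
    then obtain i where "i < d" "\<not> (u ! i = I ! \<tau> i \<and> L ! i = J ! \<tau> i)" by blast
    then show ?thesis using False by (subst prod_zero) auto
  qed
  have "(\<Sum>S\<in>Pow {..<d}. (- 1) ^ card ({..<d} - S) * tensor_act (unit_sum I J S) w L)
      = (\<Sum>S\<in>Pow {..<d}. \<Sum>u | length u = d. w u * ((- 1) ^ card ({..<d} - S) * (\<Prod>i<d. \<Sum>k\<in>S. ?e u i k)))"
    by (simp add: tensor_act_def unit_sum_def L sum_distrib_left mult.left_commute)
  also have "\<dots> = (\<Sum>u | length u = d. w u * (\<Sum>S\<in>Pow {..<d}. (- 1) ^ card ({..<d} - S) * (\<Prod>i<d. \<Sum>k\<in>S. ?e u i k)))"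
    by (subst sum.swap) (simp only: sum_distrib_left)
  also have "\<dots> = (\<Sum>u | length u = d. w u * (\<Sum>\<tau> | \<tau> permutes {..<d}. \<Prod>i<d. ?e u i (\<tau> i)))"
    by (simp only: permanent_ryser[OF finite_lessThan])
  also have "\<dots> = (\<Sum>u | length u = d. \<Sum>\<tau> | \<tau> permutes {..<d}. if u = permute_list \<tau> I \<and> L = permute_list \<tau> J then w u else 0)"
    unfolding sum_distrib_left by (intro sum.cong refl) (auto simp: delta)
  also have "\<dots> = (\<Sum>\<tau> | \<tau> permutes {..<d}. \<Sum>u | length u = d. if u = permute_list \<tau> I then (if L = permute_list \<tau> J then w u else 0) else 0)"
    by (subst sum.swap) (intro sum.cong refl, auto)
  also have "\<dots> = (\<Sum>\<tau> | \<tau> permutes {..<d}. if L = permute_list \<tau> J then w (permute_list \<tau> I) else 0)"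
    using I by (intro sum.cong refl) (subst sum.delta, auto simp: finite_words)
  finally show ?thesis .
qed

text \<open>The tensor is the image of \<open>w\<close> under the equivariant map built from
  \<open>u\<close> and the linear form "coordinate at \<open>I\<close>". This map is the combination
  of the polarized operators for \<open>I\<close> and \<open>J\<close>, with the coordinates
  \<open>u J\<close> as weights.\<close>

lemma averaged_tensor_mem:
  fixes W :: "('n::finite list \<Rightarrow> 'k::field) set"
  assumes W: "tensor.subspace W" "W \<subseteq> tensor_power d"
    and stable: "\<And>x t. t \<in> W \<Longrightarrow> tensor_act x t \<in> W"
    and w: "w \<in> W" and u: "u \<in> tensor_power d" and I: "length I = d"
  shows "(\<Sum>p | p permutes {..<d}. tensor_scale (place_permutation (inv p) w I) (place_permutation p u)) \<in> W"
    (is "?l \<in> W")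
proof -
  let ?r = "\<Sum>J | length J = d. tensor_scale (u J)
    (\<Sum>S\<in>Pow {..<d}. tensor_scale ((- 1) ^ card ({..<d} - S)) (tensor_act (unit_sum I J S) w))"
  have "?l = ?r"
  proof
    fix L
    show "?l L = ?r L"
    proof (cases "length L = d")
      case True
      have "?l L = (\<Sum>p | p permutes {..<d}. w (permute_list (inv p) I) * u (permute_list p L))"
        by (simp add: sum_fun_apply tensor_scale_def place_permutation_def)
      also have "\<dots> = (\<Sum>p | p permutes {..<d}. w (permute_list p I) * u (permute_list (inv p) L))"
        by (subst sum_permutations_inverse) (intro sum.cong refl, auto simp: permutes_inv_inv)
      also have "\<dots> = (\<Sum>p | p permutes {..<d}. \<Sum>J | length J = d.
          if J = permute_list (inv p) L then u J * w (permute_list p I) else 0)"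
        using True by (intro sum.cong refl) (subst sum.delta, auto simp: finite_words mult.commute)
      also have "\<dots> = (\<Sum>J | length J = d. \<Sum>p | p permutes {..<d}.
          if J = permute_list (inv p) L then u J * w (permute_list p I) else 0)"
        by (rule sum.swap)
      also have "\<dots> = (\<Sum>J | length J = d. u J * (\<Sum>p | p permutes {..<d}. if L = permute_list p J then w (permute_list p I) else 0))"
        unfolding sum_distrib_left
      proof (intro sum.cong refl)
        fix J :: "'n list" and p assume J: "J \<in> {J. length J = d}" and p: "p \<in> {p. p permutes {..<d}}"
        have "permute_list p (permute_list (inv p) L) = L" "permute_list (inv p) (permute_list p J) = J"
          using p J True permutes_inv[of p "{..<d}"]
          by (simp_all flip: permute_list_compose add: permutes_inv_o)
        then have "J = permute_list (inv p) L \<longleftrightarrow> L = permute_list p J" by auto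
        then show "(if J = permute_list (inv p) L then u J * w (permute_list p I) else 0)
            = u J * (if L = permute_list p J then w (permute_list p I) else 0)" by simp
      qed
      also have "\<dots> = ?r L"
        using polarized_tensor_act[OF I _ True, of _ w]
        by (auto simp: sum_fun_apply tensor_scale_def intro!: sum.cong)
      finally show ?thesis .
    next
      case False
      have "w \<in> tensor_power d" using w W by auto
      then have "tensor_act x w L = 0" for x
        using False tensor_act_in_tensor_power[of w d x] by (simp add: tensor_power_def)
      then show ?thesis using False u
        by (simp add: sum_fun_apply tensor_scale_def place_permutation_def tensor_power_def)
    qed
  qed
  also have "?r \<in> W"
    by (intro tensor.subspace_sum[OF W(1)] tensor.subspace_scale[OF W(1)] stable w)
  finally show ?thesis .
qed

text \<open>Comparing the parameters \<open>q ^ Suc m\<close> and \<open>q ^ m\<close> removes the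
  constant term; after division by \<open>q ^ m\<close> the degree has dropped by one and the
  coefficient at \<open>Suc i\<close> has gained the factor \<open>q ^ Suc i - 1\<close>. Since
  \<open>q\<close> is not a root of unity, the factors collected by the top coefficient are
  invertible.\<close>

lemma top_coefficient_mem:
  fixes W :: "('n::finite list \<Rightarrow> 'k::field) set"
  assumes W: "tensor.subspace W" and q: "q \<noteq> 0" "\<And>i. i \<ge> 1 \<Longrightarrow> q ^ i \<noteq> 1"
    and mem: "\<And>m. m \<ge> M \<Longrightarrow> (\<Sum>i\<le>N. tensor_scale ((q ^ m) ^ i) (y i)) \<in> W"
  shows "y N \<in> W"
  using mem
proof (induction N arbitrary: y)
  case 0
  then show ?case by (auto simp: tensor_scale_def)
next
  case (Suc N)
  let ?f = "\<lambda>m. \<Sum>i\<le>Suc N. tensor_scale ((q ^ m) ^ i) (y i)"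
  let ?y = "\<lambda>i. tensor_scale (q ^ Suc i - 1) (y (Suc i))"
  have "(\<Sum>i\<le>N. tensor_scale ((q ^ m) ^ i) (?y i)) \<in> W" if m: "m \<ge> M" for m
  proof -
    have "?f (Suc m) \<in> W" "?f m \<in> W" by (rule Suc.prems, use m in simp)+
    then have "tensor_scale (inverse (q ^ m)) (?f (Suc m) - ?f m) \<in> W"
      by (intro tensor.subspace_scale[OF W] tensor.subspace_diff[OF W])
    also have "tensor_scale (inverse (q ^ m)) (?f (Suc m) - ?f m) = (\<Sum>i\<le>N. tensor_scale ((q ^ m) ^ i) (?y i))"
    proof
      fix L
      have "(?f (Suc m) - ?f m) L = (\<Sum>i\<le>Suc N. ((q ^ Suc m) ^ i - (q ^ m) ^ i) * y i L)"
        by (simp add: fun_diff_def sum_fun_apply tensor_scale_def left_diff_distrib sum_subtractf del: sum.atMost_Suc power_Suc)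
      also have "\<dots> = (\<Sum>i\<le>N. ((q ^ Suc m) ^ Suc i - (q ^ m) ^ Suc i) * y (Suc i) L)"
        by (subst sum.atMost_Suc_shift) simp
      also have "\<dots> = q ^ m * (\<Sum>i\<le>N. (q ^ m) ^ i * ((q ^ Suc i - 1) * y (Suc i) L))"
        unfolding sum_distrib_left
        by (intro sum.cong refl) (simp add: power_mult_distrib algebra_simps)
      finally show "tensor_scale (inverse (q ^ m)) (?f (Suc m) - ?f m) L = (\<Sum>i\<le>N. tensor_scale ((q ^ m) ^ i) (?y i)) L"
        using q(1) by (simp add: tensor_scale_def sum_fun_apply del: sum.atMost_Suc power_Suc)
    qed
    finally show ?thesis .
  qed
  then have "?y N \<in> W" by (rule Suc.IH)
  then have "tensor_scale (inverse (q ^ Suc N - 1)) (?y N) \<in> W" by (rule tensor.subspace_scale[OF W])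
  moreover have "q ^ Suc N - 1 \<noteq> 0" using q(2)[of "Suc N"] by simp
  ultimately show ?case by (simp del: power_Suc)
qed

lemma prod_linear_coeff:
  fixes a b :: "nat \<Rightarrow> 'k::field"
  shows "degree (\<Prod>i<n. [:a i, b i:]) \<le> n" "coeff (\<Prod>i<n. [:a i, b i:]) n = (\<Prod>i<n. b i)"
proof -
  show *: "degree (\<Prod>i<n. [:a i, b i:]) \<le> n" for n
  proof -
    have "degree (\<Prod>i<n. [:a i, b i:]) \<le> (\<Sum>i<n. degree [:a i, b i:])"
      using degree_prod_sum_le[of "{..<n}" "\<lambda>i. [:a i, b i:]"] by (simp add: o_def)
    also have "\<dots> \<le> (\<Sum>i<n. 1)" by (intro sum_mono) simp
    finally show ?thesis by simp
  qed
  show "coeff (\<Prod>i<n. [:a i, b i:]) n = (\<Prod>i<n. b i)"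
  proof (induction n)
    case (Suc n)
    have "coeff (\<Prod>i<n. [:a i, b i:]) (Suc n) = 0"
      by (rule coeff_eq_0) (use *[of n] in simp)
    then show ?case using Suc by simp
  qed simp
qed

lemma prod_linear_expand:
  fixes a b :: "nat \<Rightarrow> 'k::field"
  shows "(\<Prod>i<n. a i + t * b i) = (\<Sum>j\<le>n. coeff (\<Prod>i<n. [:a i, b i:]) j * t ^ j)"
proof -
  let ?p = "\<Prod>i<n. [:a i, b i:]"
  have "(\<Prod>i<n. a i + t * b i) = poly ?p t" by (simp add: poly_prod)
  also have "\<dots> = (\<Sum>j\<le>degree ?p. coeff ?p j * t ^ j)" by (rule poly_altdef)
  also have "\<dots> = (\<Sum>j\<le>n. coeff ?p j * t ^ j)"
    using prod_linear_coeff(1)[where a = a and b = b and n = n]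
    by (intro sum.mono_neutral_left) (auto simp: coeff_eq_0)
  finally show ?thesis .
qed

section \<open>Matrices congruent to the identity modulo the maximal ideal\<close>

locale discretely_valued =
  fixes v :: "'k::field \<Rightarrow> int"
  assumes valuation: "discrete_valuation v"
begin

lemma val_mult: "x \<noteq> 0 \<Longrightarrow> y \<noteq> 0 \<Longrightarrow> v (x * y) = v x + v y"
  and val_add: "x \<noteq> 0 \<Longrightarrow> y \<noteq> 0 \<Longrightarrow> x + y \<noteq> 0 \<Longrightarrow> v (x + y) \<ge> min (v x) (v y)"
  using valuation by (auto simp: discrete_valuation_def)

lemma val_1 [simp]: "v 1 = 0"
  using val_mult[of 1 1] by simp

lemma val_minus: "x \<noteq> 0 \<Longrightarrow> v (- x) = v x"
  using val_mult[of "- 1" "- 1"] val_mult[of "- 1" x] by simp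

lemma val_power: "x \<noteq> 0 \<Longrightarrow> v (x ^ n) = int n * v x"
  by (induction n) (auto simp: val_mult algebra_simps)

lemma val_inverse: "x \<noteq> 0 \<Longrightarrow> v (inverse x) = - v x"
  using val_mult[of x "inverse x"] by simp

definition maximal_ideal :: "'k set" where
  "maximal_ideal = {x. x = 0 \<or> v x \<ge> 1}"

abbreviation "R \<equiv> valuation_ring v"
abbreviation "M \<equiv> maximal_ideal"

lemma R_0 [simp]: "0 \<in> R" and R_1 [simp]: "1 \<in> R" and M_0 [simp]: "0 \<in> M"
  by (auto simp: valuation_ring_def maximal_ideal_def)

lemma R_add: "x \<in> R \<Longrightarrow> y \<in> R \<Longrightarrow> x + y \<in> R"
  using val_add[of x y] by (fastforce simp: valuation_ring_def)

lemma M_add: "x \<in> M \<Longrightarrow> y \<in> M \<Longrightarrow> x + y \<in> M"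
  using val_add[of x y] by (fastforce simp: maximal_ideal_def)

lemma R_mult: "x \<in> R \<Longrightarrow> y \<in> R \<Longrightarrow> x * y \<in> R"
  using val_mult[of x y] by (fastforce simp: valuation_ring_def)

lemma M_mult: "x \<in> M \<Longrightarrow> y \<in> R \<Longrightarrow> x * y \<in> M"
  using val_mult[of x y] by (fastforce simp: valuation_ring_def maximal_ideal_def)

lemma R_minus: "x \<in> R \<Longrightarrow> - x \<in> R" and M_minus: "x \<in> M \<Longrightarrow> - x \<in> M"
  by (cases "x = 0"; simp add: valuation_ring_def maximal_ideal_def val_minus)+

lemma M_subset_R: "x \<in> M \<Longrightarrow> x \<in> R"
  by (auto simp: valuation_ring_def maximal_ideal_def)

lemma R_sum: "(\<And>i. i \<in> A \<Longrightarrow> f i \<in> R) \<Longrightarrow> sum f A \<in> R"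
  by (induction A rule: infinite_finite_induct) (auto intro: R_add)

lemma R_prod: "(\<And>i. i \<in> A \<Longrightarrow> f i \<in> R) \<Longrightarrow> prod f A \<in> R"
  by (induction A rule: infinite_finite_induct) (auto intro: R_mult)

lemma M_sum: "(\<And>i. i \<in> A \<Longrightarrow> f i \<in> M) \<Longrightarrow> sum f A \<in> M"
  by (induction A rule: infinite_finite_induct) (auto intro: M_add)

lemma prod_diff_M:
  assumes "\<And>i. i \<in> A \<Longrightarrow> f i \<in> R" "\<And>i. i \<in> A \<Longrightarrow> g i \<in> R" "\<And>i. i \<in> A \<Longrightarrow> f i - g i \<in> M"
  shows "prod f A - prod g A \<in> M"
  using assms
proof (induction A rule: infinite_finite_induct)
  case (insert x A)
  have "prod f (insert x A) - prod g (insert x A)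
      = (f x - g x) * prod f A + (prod f A - prod g A) * g x"
    using insert by (simp add: algebra_simps)
  also have "\<dots> \<in> M" using insert by (intro M_add M_mult R_prod) auto
  finally show ?case .
qed auto

lemma sign_R: "of_int (sign p) \<in> R"
  by (cases p rule: sign_cases) (auto intro: R_minus)

lemma det_R:
  assumes "\<And>i j. A $ i $ j \<in> R"
  shows "det A \<in> R"
  unfolding det_def by (intro R_sum R_mult R_prod sign_R assms)

lemma det_diff_M:
  assumes "\<And>i j. A $ i $ j \<in> R" "\<And>i j. B $ i $ j \<in> R" "\<And>i j. A $ i $ j - B $ i $ j \<in> M"
  shows "det A - det B \<in> M"
proof -
  have "det A - det B = (\<Sum>p | p permutes UNIV.
      ((\<Prod>i\<in>UNIV. A $ i $ p i) - (\<Prod>i\<in>UNIV. B $ i $ p i)) * of_int (sign p))"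
    unfolding det_def by (simp add: sum_subtractf algebra_simps)
  also have "\<dots> \<in> M" by (intro M_sum M_mult prod_diff_M sign_R assms)
  finally show ?thesis .
qed

text \<open>The determinant is congruent to 1 modulo the maximal ideal, hence a unit of
  \<open>R\<close>; Cramer's rule then puts the entries of the inverse into
  \<open>R\<close>.\<close>

lemma one_plus_mem_GL:
  fixes y :: "'k^'n::finite^'n"
  assumes y: "\<And>i j. y $ i $ j \<in> M"
  shows "mat 1 + y \<in> GL_over R"
proof -
  let ?A = "mat 1 + y"
  have A: "?A $ i $ j \<in> R" for i j
    using M_subset_R[OF y[of i j]] by (auto simp: mat_def intro: R_add)
  have "det ?A - det (mat 1 :: 'k^'n^'n) \<in> M"
    by (rule det_diff_M[OF A]) (auto simp: mat_def y)
  then have "1 - det ?A \<in> M" using M_minus[of "det ?A - 1"] by simp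
  moreover have "(1 :: 'k) \<notin> M" by (simp add: maximal_ideal_def)
  ultimately have notM: "det ?A \<notin> M" using M_add[of "det ?A" "1 - det ?A"] by auto
  have det: "det ?A \<noteq> 0" "v (det ?A) = 0"
    using notM det_R[OF A] by (auto simp: maximal_ideal_def valuation_ring_def)
  then have inv_R: "inverse (det ?A) \<in> R" by (simp add: valuation_ring_def val_inverse)
  have invA: "invertible ?A" using det by (simp add: invertible_det_nz)
  then have "?A ** matrix_inv ?A = mat 1"
    unfolding invertible_def matrix_inv_def by (rule someI2_ex) auto
  then have "?A *v column j (matrix_inv ?A) = axis j 1" for j
    by (simp add: vec_eq_iff matrix_matrix_mult_def matrix_vector_mult_def column_def mat_def axis_def)
  then have col: "column j (matrix_inv ?A) = (\<chi> k. det (\<chi> i l. if l = k then axis j 1 $ i else ?A $ i $ l) / det ?A)" for j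
    using cramer[OF det(1)] by blast
  have "matrix_inv ?A $ k $ j \<in> R" for k j
  proof -
    have "matrix_inv ?A $ k $ j = det (\<chi> i l. if l = k then axis j 1 $ i else ?A $ i $ l) * inverse (det ?A)"
      using arg_cong[OF col[of j], of "\<lambda>x. x $ k"] by (simp add: column_def divide_inverse)
    also have "\<dots> \<in> R" using A by (intro R_mult inv_R det_R) (auto simp: axis_def)
    finally show ?thesis .
  qed
  then show ?thesis using A invA by (simp add: GL_over_def)
qed

lemma stable_under_matrices:
  fixes W :: "('n::finite list \<Rightarrow> 'k) set"
  assumes W: "tensor.subspace W" "W \<subseteq> tensor_power d"
    and stable: "\<And>g t. g \<in> GL_over R \<Longrightarrow> t \<in> W \<Longrightarrow> tensor_act g t \<in> W"
    and w: "w \<in> W"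
  shows "tensor_act x w \<in> W"
proof -
  \<comment> \<open>The valuation is nontrivial, so some nonzero element or its inverse has positive
    valuation.\<close>
  obtain q where q: "q \<noteq> 0" "v q \<ge> 1"
  proof -
    obtain z where z: "z \<noteq> 0" "v z \<noteq> 0" using valuation by (auto simp: discrete_valuation_def)
    show ?thesis
    proof (cases "v z \<ge> 1")
      case False
      then have "inverse z \<noteq> 0" "v (inverse z) \<ge> 1" using z by (auto simp: val_inverse)
      then show ?thesis by (rule that)
    qed (use z that in auto)
  qed
  have q1: "q ^ i \<noteq> 1" if "i \<ge> 1" for i
  proof
    assume "q ^ i = 1"
    then have "int i * v q = 0" using val_power[OF q(1), of i] by simp
    then show False using that q by simp
  qed
  \<comment> \<open>A bound on the denominators of \<open>x\<close>. A zero entry enters the maximum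
    with the arbitrary integer \<open>v 0\<close>, which is harmless for a bound.\<close>
  obtain N where N: "\<And>i j. - v (x $ i $ j) < int N"
  proof -
    let ?S = "(\<lambda>(i, j). - v (x $ i $ j)) ` UNIV"
    have "- v (x $ i $ j) < int (nat (Max ?S + 1))" for i j
    proof -
      have "- v (x $ i $ j) \<le> Max ?S" by (rule Max_ge) (auto intro: image_eqI[of _ _ "(i, j)"])
      then show ?thesis by linarith
    qed
    then show ?thesis by (rule that)
  qed
  \<comment> \<open>The coefficient of \<open>t ^ j\<close> in the entry \<open>(u, L)\<close> of
    the \<open>d\<close>-th tensor power of \<open>1 + t x\<close>; for \<open>j = d\<close> it is
    the entry of the tensor power of \<open>x\<close>.\<close>
  define a where "a L u j = coeff (\<Prod>k<d. [:(mat 1 :: 'k^'n^'n) $ (u ! k) $ (L ! k), x $ (u ! k) $ (L ! k):]) j"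
    for L :: "'n list" and u j
  define y where "y j = (\<lambda>L. if length L = d then \<Sum>u | length u = d. w u * a L u j else 0)" for j
  have wd: "w \<in> tensor_power d" using W w by auto
  have expand: "tensor_act (mat 1 + (\<chi> i j. t * x $ i $ j)) w = (\<Sum>j\<le>d. tensor_scale (t ^ j) (y j))" for t
  proof
    fix L
    show "tensor_act (mat 1 + (\<chi> i j. t * x $ i $ j)) w L = (\<Sum>j\<le>d. tensor_scale (t ^ j) (y j)) L"
    proof (cases "length L = d")
      case True
      have "tensor_act (mat 1 + (\<chi> i j. t * x $ i $ j)) w L
          = (\<Sum>u | length u = d. w u * (\<Sum>j\<le>d. a L u j * t ^ j))"
        unfolding tensor_act_def a_def prod_linear_expand[symmetric] by (simp add: True)
      also have "\<dots> = (\<Sum>u | length u = d. \<Sum>j\<le>d. t ^ j * (w u * a L u j))"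
        by (simp add: sum_distrib_left mult_ac)
      also have "\<dots> = (\<Sum>j\<le>d. t ^ j * (\<Sum>u | length u = d. w u * a L u j))"
        by (subst sum.swap) (simp add: sum_distrib_left)
      finally show ?thesis using True by (simp add: sum_fun_apply tensor_scale_def y_def)
    next
      case False
      then show ?thesis using tensor_act_in_tensor_power[OF wd]
        by (simp add: sum_fun_apply tensor_scale_def y_def tensor_power_def)
    qed
  qed
  have mem: "(\<Sum>j\<le>d. tensor_scale ((q ^ m) ^ j) (y j)) \<in> W" if m: "m \<ge> Suc N" for m
  proof -
    have "q ^ m * x $ i $ j \<in> M" for i j
    proof (cases "x $ i $ j = 0")
      case False
      then have "v (q ^ m * x $ i $ j) = int m * v q + v (x $ i $ j)"
        using q by (simp add: val_mult val_power)
      moreover have "int m * v q \<ge> int m" using q by (simp add: mult_le_cancel_left1)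
      ultimately have "v (q ^ m * x $ i $ j) \<ge> 1" using N[of i j] m by linarith
      then show ?thesis by (simp add: maximal_ideal_def)
    qed simp
    then have "mat 1 + (\<chi> i j. q ^ m * x $ i $ j) \<in> GL_over R"
      by (intro one_plus_mem_GL) simp
    then show ?thesis unfolding expand[symmetric] by (rule stable[OF _ w])
  qed
  have "y d \<in> W"
  proof (rule top_coefficient_mem[OF W(1) q(1)])
    show "q ^ i \<noteq> 1" if "i \<ge> 1" for i by (rule q1[OF that])
    show "(\<Sum>j\<le>d. tensor_scale ((q ^ m) ^ j) (y j)) \<in> W" if "m \<ge> Suc N" for m by (rule mem[OF that])
  qed
  moreover have "y d = tensor_act x w"
    using wd by (auto simp: fun_eq_iff y_def a_def prod_linear_coeff tensor_act_def tensor_power_def)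
  ultimately show ?thesis by simp
qed

end

subsection \<open>The canonical tableau\<close>

lemma sum_list_take_Suc:
  fixes lam :: "nat list"
  shows "i < length lam \<Longrightarrow> sum_list (take (Suc i) lam) = sum_list (take i lam) + lam ! i"
  by (simp add: take_Suc_conv_app_nth)

lemma sum_list_take_mono:
  fixes lam :: "nat list"
  assumes "i \<le> j"
  shows "sum_list (take i lam) \<le> sum_list (take j lam)"
proof -
  have "take j lam = take i lam @ drop i (take j lam)"
    using assms append_take_drop_id[of i "take j lam"] by (simp add: min_def)
  then have "sum_list (take j lam) = sum_list (take i lam) + sum_list (drop i (take j lam))"
    by (metis sum_list_append)
  then show ?thesis by simp
qed

lemma tableau_less:
  assumes "(i, j) \<in> diagram lam" "i < i'"
  shows "tableau lam (i, j) < sum_list (take i' lam)"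
proof -
  have "tableau lam (i, j) < sum_list (take (Suc i) lam)"
    using assms by (simp add: tableau_def diagram_def sum_list_take_Suc)
  also have "\<dots> \<le> sum_list (take i' lam)" using assms by (intro sum_list_take_mono) simp
  finally show ?thesis .
qed

text \<open>Successive rows occupy successive intervals, which gives injectivity; surjectivity
  follows by counting cells.\<close>

lemma bij_betw_tableau: "bij_betw (tableau lam) (diagram lam) {..<sum_list lam}"
proof -
  have less: "tableau lam (i, j) < tableau lam (i', j')" if "(i, j) \<in> diagram lam" "i < i'" for i j i' j'
    using tableau_less[OF that] by (simp add: tableau_def)
  have inj: "inj_on (tableau lam) (diagram lam)"
  proof (rule inj_onI)
    fix x y assume c: "x \<in> diagram lam" "y \<in> diagram lam" "tableau lam x = tableau lam y"
    have "fst x = fst y"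
      using less[of "fst x" "snd x" "fst y" "snd y"] less[of "fst y" "snd y" "fst x" "snd x"] c
      by (cases "fst x" "fst y" rule: linorder_cases) auto
    then show "x = y" using c(3) by (simp add: tableau_def case_prod_unfold prod_eq_iff)
  qed
  moreover have "tableau lam ` diagram lam \<subseteq> {..<sum_list lam}"
  proof
    fix x assume "x \<in> tableau lam ` diagram lam"
    then obtain i j where c: "(i, j) \<in> diagram lam" "x = tableau lam (i, j)" by auto
    then have "i < length lam" by (simp add: diagram_def)
    then show "x \<in> {..<sum_list lam}" using tableau_less[OF c(1), of "length lam"] c(2) by simp
  qed
  moreover have "card (tableau lam ` diagram lam) = card {..<sum_list lam}"
  proof -
    have "diagram lam = (SIGMA i:{..<length lam}. {..<lam ! i})" by (auto simp: diagram_def)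
    then have "card (diagram lam) = sum_list lam"
      by (simp add: sum_list_sum_nth atLeast0LessThan)
    then show ?thesis by (simp add: card_image[OF inj])
  qed
  ultimately show ?thesis
    unfolding bij_betw_def by (intro conjI card_subset_eq) auto
qed

section \<open>Comparison with the given row and column groups\<close>

definition row_of :: "nat list \<Rightarrow> nat \<Rightarrow> nat" where
  "row_of lam x = fst (inv_into (diagram lam) (tableau lam) x)"

definition column_of :: "nat list \<Rightarrow> nat \<Rightarrow> nat" where
  "column_of lam x = snd (inv_into (diagram lam) (tableau lam) x)"

lemma labelled_diagram_tableau:
  assumes "sorted_wrt (\<ge>) lam"
  shows "labelled_diagram {..<sum_list lam} (row_of lam) (column_of lam) lam"
proof
  have "bij_betw (inv_into (diagram lam) (tableau lam)) {..<sum_list lam} (diagram lam)"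
    by (rule bij_betw_inv_into[OF bij_betw_tableau])
  then show "bij_betw (\<lambda>x. (row_of lam x, column_of lam x)) {..<sum_list lam} (diagram lam)"
    by (simp add: row_of_def column_of_def)
qed (rule assms)

lemma tableau_image:
  "tableau lam ` {c \<in> diagram lam. P c}
    = {x \<in> {..<sum_list lam}. P (inv_into (diagram lam) (tableau lam) x)}"
proof -
  have bij: "inj_on (tableau lam) (diagram lam)" "tableau lam ` diagram lam = {..<sum_list lam}"
    using bij_betw_tableau by (auto simp: bij_betw_def)
  show ?thesis
  proof (intro equalityI subsetI)
    fix x assume "x \<in> tableau lam ` {c \<in> diagram lam. P c}"
    then show "x \<in> {x \<in> {..<sum_list lam}. P (inv_into (diagram lam) (tableau lam) x)}"
      using bij by (auto simp: inv_into_f_f)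
  next
    fix x assume x: "x \<in> {x \<in> {..<sum_list lam}. P (inv_into (diagram lam) (tableau lam) x)}"
    then have "x \<in> tableau lam ` diagram lam" using bij by simp
    then show "x \<in> tableau lam ` {c \<in> diagram lam. P c}"
      using x f_inv_into_f[of x "tableau lam" "diagram lam"] inv_into_into[of x "tableau lam" "diagram lam"]
      by (metis (mono_tags, lifting) image_eqI mem_Collect_eq)
  qed
qed

text \<open>An injective map of a finite level set into itself is onto. This reconciles the setwise
  description of the row and column groups with the labels used by \<open>stab\<close>.\<close>

lemma permutes_label_iff:
  assumes A: "finite A" and p: "p permutes A"
  shows "(\<forall>i. p ` {x \<in> A. f x = i} = {x \<in> A. f x = i}) \<longleftrightarrow> (\<forall>x\<in>A. f (p x) = f x)"
proof
  assume "\<forall>i. p ` {x \<in> A. f x = i} = {x \<in> A. f x = i}"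
  then show "\<forall>x\<in>A. f (p x) = f x" by blast
next
  assume f: "\<forall>x\<in>A. f (p x) = f x"
  show "\<forall>i. p ` {x \<in> A. f x = i} = {x \<in> A. f x = i}"
  proof
    fix i
    show "p ` {x \<in> A. f x = i} = {x \<in> A. f x = i}"
      by (rule endo_inj_surj) (use A p f permutes_inj_on[OF p] permutes_in_image[OF p] in auto)
  qed
qed

lemma app_mem_row_group: "app p \<in> row_group lam \<longleftrightarrow> p \<in> stab {..<sum_list lam} (row_of lam)"
  using permutes_label_iff[of "{..<sum_list lam}" "app p" "row_of lam"]
  by (auto simp: row_group_def mem_stab_iff tableau_image row_of_def)

lemma app_mem_column_group: "app p \<in> column_group lam \<longleftrightarrow> p \<in> stab {..<sum_list lam} (column_of lam)"
  using permutes_label_iff[of "{..<sum_list lam}" "app p" "column_of lam"]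
  by (auto simp: column_group_def mem_stab_iff tableau_image column_of_def)

lemma sgnp_eq: "sgnp p = sign (app p)"
  by transfer simp

text \<open>The bridge from the integral computation to \<open>K\<close>: the formulas are proved
  over the integers, where cancellation is possible, and the coefficients are mapped to
  \<open>K\<close> only afterwards.\<close>

lemma young_symmetrizer_app:
  assumes "sorted_wrt (\<ge>) lam"
  shows "young_symmetrizer lam (app p)
    = (of_int (Poly_Mapping.lookup (labelled_diagram.young_sum {..<sum_list lam} (row_of lam) (column_of lam) 0) p) :: 'k::field)"
proof -
  interpret labelled_diagram "{..<sum_list lam}" "row_of lam" "column_of lam" lam
    by (rule labelled_diagram_tableau[OF assms])
  have "(young_symmetrizer lam (app p) :: 'k)
      = (\<Sum>q\<in>sym. row_symmetrizer lam (app q) * column_antisymmetrizer lam (inv (app q) \<circ> app p))"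
    unfolding young_symmetrizer_def group_algebra_mult_def
    by (rule sum.reindex_bij_betw[OF bij_betw_app_stab, symmetric]) simp
  also have "\<dots> = (\<Sum>q\<in>sym. if q \<in> row_perms then (if - q + p \<in> column_perms then of_int (sgnp (- q + p)) else 0) else 0)"
  proof (intro sum.cong refl)
    fix q
    have "inv (app q) \<circ> app p = app (- q + p)" by (simp add: fun_eq_iff app_uminus)
    then show "row_symmetrizer lam (app q) * column_antisymmetrizer lam (inv (app q) \<circ> app p)
      = (if q \<in> row_perms then (if - q + p \<in> column_perms then of_int (sgnp (- q + p)) else 0) else 0 :: 'k)"
      by (simp add: row_symmetrizer_def column_antisymmetrizer_def app_mem_row_group app_mem_column_group sgnp_eq)
  qed
  also have "\<dots> = (\<Sum>q | q \<in> sym \<and> q \<in> row_perms. if - q + p \<in> column_perms then of_int (sgnp (- q + p)) else 0)"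
    by (rule sum.inter_filter[symmetric]) (simp add: finite_stab)
  also have "{q. q \<in> sym \<and> q \<in> row_perms} = row_perms" using stab_subset_sym by blast
  finally show ?thesis unfolding lookup_young_sum of_int_sum by (simp add: if_distrib cong: if_cong)
qed

subsection \<open>Action on tensors\<close>

abbreviation perms :: "nat \<Rightarrow> nat fperm set" where
  "perms d \<equiv> stab {..<d} (\<lambda>_. ())"

text \<open>Integral elements act through the images of their coefficients in \<open>K\<close>.
  Coefficients outside \<open>perms d\<close> are ignored, hence the support condition in
  \<open>ring_act_mult\<close>.\<close>

definition ring_act :: "nat \<Rightarrow> nat group_ring \<Rightarrow> ('n::finite list \<Rightarrow> 'k::field) \<Rightarrow> 'n list \<Rightarrow> 'k" where
  "ring_act d x t = (\<Sum>p\<in>perms d. tensor_scale (of_int (Poly_Mapping.lookup x p)) (place_permutation (app p) t))"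

lemma place_permutation_plus:
  assumes "q \<in> perms d" "t \<in> tensor_power d"
  shows "place_permutation (app p) (place_permutation (app q) t) = place_permutation (app (p + q)) t"
proof
  fix w
  have "app (p + q) = app p \<circ> app q" by (simp add: fun_eq_iff)
  then show "place_permutation (app p) (place_permutation (app q) t) w = place_permutation (app (p + q)) t w"
    using assms by (cases "length w = d")
      (auto simp: place_permutation_def permute_list_compose mem_stab_iff tensor_power_def)
qed

lemma place_permutation_sum:
  "place_permutation p (\<Sum>i\<in>A. tensor_scale (c i) (f i)) = (\<Sum>i\<in>A. tensor_scale (c i) (place_permutation p (f i)))"
  by (simp add: fun_eq_iff place_permutation_def sum_fun_apply tensor_scale_def)

lemma ring_act_tensor_power: "t \<in> tensor_power d \<Longrightarrow> ring_act d x t \<in> tensor_power d"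
  by (auto simp: ring_act_def tensor_power_def sum_fun_apply tensor_scale_def place_permutation_def)

lemma ring_act_sum:
  "ring_act d x (\<Sum>i\<in>A. tensor_scale (c i) (f i)) = (\<Sum>i\<in>A. tensor_scale (c i) (ring_act d x (f i)))"
proof
  fix w
  have "ring_act d x (\<Sum>i\<in>A. tensor_scale (c i) (f i)) w
      = (\<Sum>p\<in>perms d. \<Sum>i\<in>A. c i * (of_int (Poly_Mapping.lookup x p) * place_permutation (app p) (f i) w))"
    unfolding ring_act_def place_permutation_sum
    by (simp add: sum_fun_apply tensor_scale_def sum_distrib_left mult.left_commute)
  also have "\<dots> = (\<Sum>i\<in>A. \<Sum>p\<in>perms d. c i * (of_int (Poly_Mapping.lookup x p) * place_permutation (app p) (f i) w))"
    by (rule sum.swap)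
  also have "\<dots> = (\<Sum>i\<in>A. tensor_scale (c i) (ring_act d x (f i))) w"
    by (simp add: sum_fun_apply tensor_scale_def ring_act_def sum_distrib_left)
  finally show "ring_act d x (\<Sum>i\<in>A. tensor_scale (c i) (f i)) w = (\<Sum>i\<in>A. tensor_scale (c i) (ring_act d x (f i))) w" .
qed

lemma lookup_mult_supported:
  fixes x y :: "'a group_ring"
  assumes "finite S" "\<And>p. p \<notin> S \<Longrightarrow> Poly_Mapping.lookup x p = 0"
  shows "Poly_Mapping.lookup (x * y) s = (\<Sum>p\<in>S. Poly_Mapping.lookup x p * Poly_Mapping.lookup y (- p + s))"
proof -
  have "x = (\<Sum>p\<in>S. of_int (Poly_Mapping.lookup x p) * gelem p)"
  proof (rule poly_mapping_eqI)
    fix k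
    have "Poly_Mapping.lookup (\<Sum>p\<in>S. of_int (Poly_Mapping.lookup x p) * gelem p) k
        = (\<Sum>p\<in>S. if p = k then Poly_Mapping.lookup x p else 0)"
      unfolding lookup_sum by (intro sum.cong) (auto simp: lookup_of_int_mult lookup_single when_def)
    then show "Poly_Mapping.lookup x k = Poly_Mapping.lookup (\<Sum>p\<in>S. of_int (Poly_Mapping.lookup x p) * gelem p) k"
      using assms by simp
  qed
  then have "x * y = (\<Sum>p\<in>S. of_int (Poly_Mapping.lookup x p) * gelem p) * y"
    by (rule arg_cong)
  also have "\<dots> = (\<Sum>p\<in>S. of_int (Poly_Mapping.lookup x p) * (gelem p * y))"
    by (simp only: sum_distrib_right mult.assoc)
  finally show ?thesis by (simp add: lookup_sum lookup_of_int_mult lookup_gelem_mult)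
qed

lemma ring_act_mult:
  assumes x: "\<And>p. p \<notin> perms d \<Longrightarrow> Poly_Mapping.lookup x p = 0" and t: "t \<in> tensor_power d"
  shows "ring_act d x (ring_act d y t) = ring_act d (x * y) t"
proof
  fix w
  let ?x = "\<lambda>p. of_int (Poly_Mapping.lookup x p)" and ?y = "\<lambda>p. of_int (Poly_Mapping.lookup y p)"
  let ?t = "\<lambda>p. place_permutation (app p) t w"
  have "ring_act d x (ring_act d y t) w
      = (\<Sum>p\<in>perms d. \<Sum>q\<in>perms d. ?x p * ?y q * place_permutation (app p) (place_permutation (app q) t) w)"
    unfolding ring_act_def place_permutation_sum
    by (simp add: sum_fun_apply tensor_scale_def sum_distrib_left mult.assoc)
  also have "\<dots> = (\<Sum>p\<in>perms d. \<Sum>q\<in>perms d. ?x p * ?y q * ?t (p + q))"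
    using place_permutation_plus[OF _ t] by simp
  also have "\<dots> = (\<Sum>p\<in>perms d. \<Sum>s\<in>perms d. ?x p * ?y (- p + s) * ?t s)"
  proof (rule sum.cong)
    fix p assume p: "p \<in> perms d"
    show "(\<Sum>q\<in>perms d. ?x p * ?y q * ?t (p + q)) = (\<Sum>s\<in>perms d. ?x p * ?y (- p + s) * ?t s)"
      by (rule sum.reindex_bij_witness[of _ "\<lambda>s. - p + s" "\<lambda>q. p + q"])
        (use p in \<open>auto simp: stab_plus stab_uminus add.assoc[symmetric]\<close>)
  qed simp
  also have "\<dots> = (\<Sum>s\<in>perms d. \<Sum>p\<in>perms d. ?x p * ?y (- p + s) * ?t s)"
    by (rule sum.swap)
  also have "\<dots> = ring_act d (x * y) t w"
    by (simp add: ring_act_def sum_fun_apply tensor_scale_def sum_distrib_right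
        lookup_mult_supported[of "perms d" x y, OF finite_stab x])
  finally show "ring_act d x (ring_act d y t) w = ring_act d (x * y) t w" .
qed

lemma ring_act_gelem:
  assumes "p \<in> perms d"
  shows "ring_act d (gelem p) t = place_permutation (app p) t"
proof -
  have "ring_act d (gelem p) t = (\<Sum>q\<in>perms d. if q = p then place_permutation (app q) t else 0)"
    unfolding ring_act_def by (intro sum.cong) (auto simp: lookup_single when_def)
  then show ?thesis using assms by (simp add: finite_stab)
qed

lemma ring_act_of_int_mult: "ring_act d (of_int m * x) t = tensor_scale (of_int m) (ring_act d x t)"
  by (simp add: ring_act_def fun_eq_iff sum_fun_apply tensor_scale_def lookup_of_int_mult sum_distrib_left mult.assoc)

lemma group_algebra_act_eq_ring_act:
  assumes "\<And>p. a (app p) = of_int (Poly_Mapping.lookup x p)"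
  shows "group_algebra_act d a t = ring_act d x t"
  unfolding group_algebra_act_def ring_act_def
  by (subst sum.reindex_bij_betw[OF bij_betw_app_stab, symmetric]) (simp_all add: assms)

theorem theorem4p1:
  fixes v :: "'k::field \<Rightarrow> int"
    and d :: nat
    and lam :: "nat list"
  assumes "discrete_valuation v"
    and "d \<ge> 1"
    and "partition_of d lam"
    and "is_core CHAR('k) lam"
  shows "\<not> (\<exists>W :: ('n::finite list \<Rightarrow> 'k) set.
            tensor.subspace W \<and> W \<noteq> {0} \<and> W \<subset> schur_module lam \<and>
            (\<forall>g :: 'k^'n^'n. g \<in> GL_over (valuation_ring v) \<longrightarrow> schur_rep lam g ` W \<subseteq> W))"
proof
  assume "\<exists>W :: ('n list \<Rightarrow> 'k) set.
            tensor.subspace W \<and> W \<noteq> {0} \<and> W \<subset> schur_module lam \<and>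
            (\<forall>g :: 'k^'n^'n. g \<in> GL_over (valuation_ring v) \<longrightarrow> schur_rep lam g ` W \<subseteq> W)"
  then obtain W :: "('n list \<Rightarrow> 'k) set" where W: "tensor.subspace W" "W \<noteq> {0}" "W \<subset> schur_module lam"
    and GL: "\<And>g :: 'k^'n^'n. g \<in> GL_over (valuation_ring v) \<Longrightarrow> schur_rep lam g ` W \<subseteq> W" by blast
  have lam: "sorted_wrt (\<ge>) lam" "sum_list lam = d" using assms(3) by (auto simp: partition_of_def)
  interpret discretely_valued v by unfold_locales (rule assms(1))
  interpret labelled_diagram "{..<d}" "row_of lam" "column_of lam" lam
    using labelled_diagram_tableau[OF lam(1)] by (simp add: lam(2))
  define c where "c = young_sum 0"
  define H where "H = (\<Prod>h\<in>diagram lam. hook_length lam h)"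
  have act: "group_algebra_act d (young_symmetrizer lam) t = ring_act d c t" for t :: "'n list \<Rightarrow> 'k"
    by (rule group_algebra_act_eq_ring_act) (use young_symmetrizer_app[OF lam(1)] in \<open>simp add: c_def lam(2)\<close>)
  have schur: "schur_module lam = ring_act d c ` (tensor_power d :: ('n list \<Rightarrow> 'k) set)"
    by (simp add: schur_module_def lam(2) act)
  have c_perms: "Poly_Mapping.lookup c p = 0" if "p \<notin> perms d" for p
    using that lookup_young_sum_eq_0 by (simp add: c_def)
  have sandwich: "ring_act d c (place_permutation (app p) (ring_act d c t))
      = tensor_scale (of_nat H * of_int (Poly_Mapping.lookup c (- p))) (ring_act d c t)"
    if p: "p \<in> perms d" and t: "t \<in> tensor_power d" for p and t :: "'n list \<Rightarrow> 'k"
  proof -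
    have "Poly_Mapping.lookup (gelem p) q = 0" if "q \<notin> perms d" for q
      using that p by (auto simp: lookup_single when_def)
    then have "ring_act d c (place_permutation (app p) (ring_act d c t)) = ring_act d (c * gelem p * c) t"
      using c_perms t by (simp add: ring_act_gelem[OF p, symmetric] ring_act_mult mult.assoc)
    also have "c * gelem p * c = of_int (int H * Poly_Mapping.lookup c (- p)) * c"
      unfolding c_def H_def by (rule young_sum_sandwich[OF p])
    finally show ?thesis by (simp only: ring_act_of_int_mult) simp
  qed
  \<comment> \<open>The sandwich formula at the identity, where \<open>c\<close> has coefficient 1:
    the symmetrizer acts on its image as the scalar \<open>H\<close>.\<close>
  have square: "ring_act d c t = tensor_scale (of_nat H) t" if t: "t \<in> schur_module lam" for t :: "'n list \<Rightarrow> 'k"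
  proof -
    obtain s where s: "s \<in> tensor_power d" "t = ring_act d c s" using t by (auto simp: schur)
    have "place_permutation (app 0) t = t" by (simp add: fun_eq_iff place_permutation_def zero_fperm.rep_eq)
    then show ?thesis using sandwich[of 0, OF _ s(1)] by (simp add: s(2) c_def lookup_young_sum_0)
  qed
  \<comment> \<open>Here the core condition enters; in characteristic 0 it says that the hook
    lengths are nonzero.\<close>
  have "of_nat (hook_length lam h) \<noteq> (0 :: 'k)" if "h \<in> diagram lam" for h
    using assms(4) that by (simp add: is_core_def of_nat_eq_0_iff_char_dvd)
  then have H: "of_nat H \<noteq> (0 :: 'k)" by (simp add: H_def finite_diagram)
  have WT: "W \<subseteq> tensor_power d" using W(3) ring_act_tensor_power unfolding schur by blast
  have stable: "tensor_act g t \<in> W" if "g \<in> GL_over (valuation_ring v)" "t \<in> W" for g t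
    using GL[OF that(1)] that(2) W(3) by (auto simp: schur_rep_def image_subset_iff)
  have matrices: "tensor_act x t \<in> W" if "t \<in> W" for x t
    by (rule stable_under_matrices[OF W(1) WT stable that])
  have "0 \<in> W" using W(1) by (rule tensor.subspace_0)
  then obtain w where w: "w \<in> W" "w \<noteq> 0" using W(2) by blast
  \<comment> \<open>The coordinate at \<open>I\<close> serves as the linear form that does not
    vanish at \<open>w\<close>.\<close>
  then obtain I where I: "w I \<noteq> 0" by (auto simp: fun_eq_iff)
  then have lenI: "length I = d" using w WT by (auto simp: tensor_power_def)
  have "u \<in> W" if u: "u \<in> schur_module lam" for u
  proof -
    obtain s where s: "s \<in> tensor_power d" "u = ring_act d c s" using u by (auto simp: schur)
    define \<phi> where "\<phi> = (\<Sum>p\<in>perms d. tensor_scale (place_permutation (app (- p)) w I) (place_permutation (app p) u))"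
    have "\<phi> = (\<Sum>p | p permutes {..<d}. tensor_scale (place_permutation (inv p) w I) (place_permutation p u))"
      unfolding \<phi>_def app_uminus by (rule sum.reindex_bij_betw[OF bij_betw_app_stab]) simp
    also have "\<dots> \<in> W"
      using s ring_act_tensor_power by (intro averaged_tensor_mem[OF W(1) WT matrices w(1) _ lenI]) auto
    finally have \<phi>: "\<phi> \<in> W" .
    \<comment> \<open>Two evaluations of \<open>c\<close> on \<open>\<phi>\<close>: as the scalar
      \<open>H\<close>, since \<open>\<phi>\<close> is in the Schur module, and term by term through
      the sandwich formula. In the second the scalars add up to \<open>H\<close> times the
      coordinate at \<open>I\<close> of \<open>c w\<close>, and \<open>c w\<close> is
      \<open>H\<close> times \<open>w\<close>. So a nonzero multiple of \<open>u\<close> lies in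
      \<open>W\<close>.\<close>
    have "tensor_scale (of_nat H) \<phi> = ring_act d c \<phi>" using square[of \<phi>] \<phi> W(3) by auto
    also have "\<dots> = (\<Sum>p\<in>perms d. tensor_scale (place_permutation (app (- p)) w I)
        (tensor_scale (of_nat H * of_int (Poly_Mapping.lookup c (- p))) u))"
      unfolding \<phi>_def ring_act_sum using s by (simp add: sandwich)
    also have "\<dots> = tensor_scale (of_nat H * (\<Sum>p\<in>perms d. of_int (Poly_Mapping.lookup c (- p)) * place_permutation (app (- p)) w I)) u"
      by (simp add: fun_eq_iff sum_fun_apply tensor_scale_def sum_distrib_left sum_distrib_right mult_ac)
    also have "(\<Sum>p\<in>perms d. of_int (Poly_Mapping.lookup c (- p)) * place_permutation (app (- p)) w I)
        = (\<Sum>p\<in>perms d. of_int (Poly_Mapping.lookup c p) * place_permutation (app p) w I)"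
      by (rule sum.reindex_bij_witness[of _ uminus uminus]) (auto simp: stab_uminus)
    also have "\<dots> = ring_act d c w I" by (simp add: ring_act_def sum_fun_apply tensor_scale_def)
    also have "\<dots> = of_nat H * w I" using square[of w] w(1) W(3) by (auto simp: tensor_scale_def)
    finally have "tensor_scale (of_nat H * (of_nat H * w I)) u \<in> W"
      using tensor.subspace_scale[OF W(1) \<phi>, of "of_nat H"] by simp
    then have "tensor_scale (inverse (of_nat H * (of_nat H * w I))) (tensor_scale (of_nat H * (of_nat H * w I)) u) \<in> W"
      by (rule tensor.subspace_scale[OF W(1)])
    moreover have "inverse (of_nat H * (of_nat H * w I)) * (of_nat H * (of_nat H * w I)) = 1"
      using H I by (intro left_inverse) simp
    ultimately show "u \<in> W" by (simp only: tensor.scale_scale tensor.scale_one)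
  qed
  then show False using W(3) by blast
qed

end
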